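(* Let $m\geq 1$. A $2^m\times 2^m$ complex matrix $U$ can be exactly represented by an $m$-qubit circuit over $\mathcal{G}_{24}$ (possibly using ancillas) if and only if $U$ is unitary with all entries in $\mathcal{R}_{24}$. Furthermore, 2 ancillas suffice to synthesize a circuit for such a $U$.
   Context: For $n$ divisible by 8, let $\zeta_n=e^{2\pi i/n}$ and let $\mathcal{G}_n$ be the gate set consisting of $H=\frac{1}{\sqrt2}\begin{bmatrix}1&1\\1&-1\end{bmatrix}$, $S=\mathrm{diag}(1,i)$, the two-qubit controlled-not $CX$, and $T_n=\mathrm{diag}(1,\zeta_n)$. $\mathcal{R}_n$ denotes the smallest subring of $\mathbb{C}$ containing $1/2$ and $\zeta_n$. An $m$-qubit unitary $U$ is exactly represented by a circuit over $\mathcal{G}_n$ using $a$ ancillas if there is a circuit $C$ over $\mathcal{G}_n$ on $m+a$ qubits such that $C(\mathbf{u}\otimes \mathbf{e}_0)=(U\mathbf{u})\otimes\mathbf{e}_0$ for every $\mathbf{u}\in\mathbb{C}^{2^m}$, where $\mathbf{e}_0$ is the all-zero computational basis state of the $a$ ancilla qubits. *)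

theory Defs
  imports Complex_Main "Jordan_Normal_Form.Matrix"
begin

definition zeta :: "nat \<Rightarrow> complex" where
  "zeta n = cis (2 * pi / real n)"

inductive_set Rring :: "nat \<Rightarrow> complex set" for n :: nat where
  one:  "1 \<in> Rring n"
| half: "1/2 \<in> Rring n"
| zet:  "zeta n \<in> Rring n"
| add:  "x \<in> Rring n \<Longrightarrow> y \<in> Rring n \<Longrightarrow> x + y \<in> Rring n"
| neg:  "x \<in> Rring n \<Longrightarrow> - x \<in> Rring n"
| mul:  "x \<in> Rring n \<Longrightarrow> y \<in> Rring n \<Longrightarrow> x * y \<in> Rring n"

definition adjoint_mat :: "complex mat \<Rightarrow> complex mat" where
  "adjoint_mat A = mat (dim_col A) (dim_row A) (\<lambda>(i,j). cnj (A $$ (j,i)))"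

definition unitary_mat :: "nat \<Rightarrow> complex mat \<Rightarrow> bool" where
  "unitary_mat d U \<longleftrightarrow> U \<in> carrier_mat d d \<and>
     adjoint_mat U * U = 1\<^sub>m d \<and> U * adjoint_mat U = 1\<^sub>m d"

text \<open>Basis states of a k-qubit register are indexed by 0..<2^k; qubit j of index x
  is the bit (x div 2^j) mod 2.  Tensor products u \<otimes> v are in the Kronecker
  (row-major) convention: (u \<otimes> v) at index i*dim v + j is u_i * v_j.\<close>

definition qbit :: "nat \<Rightarrow> nat \<Rightarrow> nat" where
  "qbit j x = (x div 2 ^ j) mod 2"

definition Hgate :: "complex mat" where
  "Hgate = mat 2 2 (\<lambda>(i,j). (if i = 1 \<and> j = 1 then -1 else 1) / complex_of_real (sqrt 2))"

definition Sgate :: "complex mat" where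
  "Sgate = mat 2 2 (\<lambda>(i,j). if i \<noteq> j then 0 else if i = 0 then 1 else \<i>)"

definition Tgate :: "nat \<Rightarrow> complex mat" where
  "Tgate n = mat 2 2 (\<lambda>(i,j). if i \<noteq> j then 0 else if i = 0 then 1 else zeta n)"

datatype gate = Single "complex mat" nat | CNOT nat nat

definition single_on :: "nat \<Rightarrow> complex mat \<Rightarrow> nat \<Rightarrow> complex mat" where
  "single_on k g q = mat (2^k) (2^k) (\<lambda>(r,c).
     if (\<forall>j. j \<noteq> q \<longrightarrow> qbit j r = qbit j c) then g $$ (qbit q r, qbit q c) else 0)"

definition cx_map :: "nat \<Rightarrow> nat \<Rightarrow> nat \<Rightarrow> nat" where
  "cx_map ctl tgt x = (if qbit ctl x = 1 then
      (if qbit tgt x = 1 then x - 2^tgt else x + 2^tgt) else x)"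

definition cx_on :: "nat \<Rightarrow> nat \<Rightarrow> nat \<Rightarrow> complex mat" where
  "cx_on k ctl tgt = mat (2^k) (2^k) (\<lambda>(r,c). if r = cx_map ctl tgt c then 1 else 0)"

fun gate_mat :: "nat \<Rightarrow> gate \<Rightarrow> complex mat" where
  "gate_mat k (Single g q) = single_on k g q"
| "gate_mat k (CNOT c t) = cx_on k c t"

fun valid_gate :: "nat \<Rightarrow> nat \<Rightarrow> gate \<Rightarrow> bool" where
  "valid_gate n k (Single g q) \<longleftrightarrow> q < k \<and> g \<in> {Hgate, Sgate, Tgate n}"
| "valid_gate n k (CNOT c t) \<longleftrightarrow> c < k \<and> t < k \<and> c \<noteq> t"

definition circuit_mat :: "nat \<Rightarrow> gate list \<Rightarrow> complex mat" where
  "circuit_mat k C = foldl (\<lambda>M g. gate_mat k g * M) (1\<^sub>m (2^k)) C"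

definition circuit_over :: "nat \<Rightarrow> nat \<Rightarrow> gate list \<Rightarrow> bool" where
  "circuit_over n k C \<longleftrightarrow> (\<forall>g \<in> set C. valid_gate n k g)"

text \<open>u \<otimes> e_0, where e_0 is the all-zero basis state of a ancillas.\<close>
definition with_ancillas :: "nat \<Rightarrow> complex vec \<Rightarrow> complex vec" where
  "with_ancillas a u = vec (dim_vec u * 2^a)
     (\<lambda>i. if i mod 2^a = 0 then u $ (i div 2^a) else 0)"

definition exactly_represents :: "nat \<Rightarrow> nat \<Rightarrow> nat \<Rightarrow> complex mat \<Rightarrow> bool" where
  "exactly_represents n m a U \<longleftrightarrow>
     (\<exists>C. circuit_over n (m + a) C \<and>
       (\<forall>u \<in> carrier_vec (2^m).
          circuit_mat (m + a) C *\<^sub>v with_ancillas a u = with_ancillas a (U *\<^sub>v u)))"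

end

theory Submission
  imports Defs "Jordan_Normal_Form.Determinant"
begin

text \<open>
  Since \<open>R\<^sub>2\<^sub>4 = R\<^sub>1\<^sub>2 + \<zeta>\<^sub>8 R\<^sub>1\<^sub>2\<close> is free over \<open>R\<^sub>1\<^sub>2 = \<int>[1/2, \<i>, \<omega>]\<close>, a unitary \<open>U = A + \<zeta>\<^sub>8 B\<close> yields a unitary
  \<open>W = A \<otimes> I + B \<otimes> \<Lambda>\<close> over \<open>R\<^sub>1\<^sub>2\<close>, where \<open>\<Lambda>\<close> is a two by two matrix with \<open>\<Lambda>\<^sup>2 = \<i>\<close>; on an eigenvector of \<open>\<Lambda>\<close>
  for \<open>\<zeta>\<^sub>8\<close>, prepared in the first ancilla, \<open>W\<close> acts as \<open>U\<close>.

  Over \<open>R\<^sub>1\<^sub>2\<close> a unit vector is \<open>w / (1 + \<i>)\<^sup>k\<close> with \<open>w\<close> integral, and \<open>|w\<^sub>j|\<^sup>2 = x\<^sub>j + y\<^sub>j \<surd>3\<close> with \<open>\<Sum> x\<^sub>j = 2\<^sup>k\<close> and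
  \<open>\<Sum> y\<^sub>j = 0\<close>. An entry that is prime to \<open>1 + \<i>\<close> has exactly one of \<open>x\<^sub>j, y\<^sub>j\<close> odd, so for \<open>k > 0\<close> such entries
  of each type occur in even number, and two entries of the same type agree modulo 2 up to a root of
  unity. Hence a phase and the two-level operator \<open>(1 + \<i>)\<^sup>-\<^sup>1 [[1, 1], [1, -1]]\<close> make both of them divisible
  by \<open>1 + \<i>\<close>. This lowers \<open>k\<close> to 0, where the vector is a root of unity times a basis vector, and so
  decomposes \<open>W\<close> column by column into one- and two-level operators. These are circuits that use the
  second ancilla, through multiply controlled flips built from commutators.
\<close>

subsection \<open>Circuits as operators on amplitude functions\<close>

text \<open>Amplitude functions live on all of \<open>nat\<close>, which keeps the number of wires out of the operators;
  wire \<open>q\<close> is bit \<open>q\<close> of the argument.\<close>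

type_synonym state = "nat \<Rightarrow> complex"

definition hadamard_op :: "nat \<Rightarrow> state \<Rightarrow> state" where
  "hadamard_op q \<psi> = (\<lambda>x. ((if bit x q then - \<psi> x else \<psi> x) + \<psi> (flip_bit q x)) / complex_of_real (sqrt 2))"

definition diag_op :: "(nat \<Rightarrow> complex) \<Rightarrow> state \<Rightarrow> state" where
  "diag_op d \<psi> = (\<lambda>x. d x * \<psi> x)"

definition phase_op :: "nat \<Rightarrow> complex \<Rightarrow> state \<Rightarrow> state" where
  "phase_op q z = diag_op (\<lambda>x. if bit x q then z else 1)"

definition ctl :: "nat set \<Rightarrow> nat \<Rightarrow> bool" where
  "ctl A x \<longleftrightarrow> (\<forall>a\<in>A. bit x a)"

definition mcmap :: "nat set \<Rightarrow> nat \<Rightarrow> nat \<Rightarrow> nat" where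
  "mcmap A t x = (if ctl A x then flip_bit t x else x)"

definition perm_op :: "(nat \<Rightarrow> nat) \<Rightarrow> state \<Rightarrow> state" where
  "perm_op f \<psi> = (\<lambda>x. \<psi> (f x))"

abbreviation mcx :: "nat set \<Rightarrow> nat \<Rightarrow> state \<Rightarrow> state" where
  "mcx A t \<equiv> perm_op (mcmap A t)"

text \<open>These are the actions of circuits on \<open>k\<close> wires. The gate S needs no rule of
  its own: diag(1, i) is the sixth power of diag(1, \<open>zeta 24\<close>).\<close>

inductive_set impl :: "nat \<Rightarrow> (state \<Rightarrow> state) set" for k :: nat where
  impl_id: "id \<in> impl k"
| impl_h: "f \<in> impl k \<Longrightarrow> q < k \<Longrightarrow> hadamard_op q \<circ> f \<in> impl k"
| impl_t: "f \<in> impl k \<Longrightarrow> q < k \<Longrightarrow> phase_op q (zeta 24) \<circ> f \<in> impl k"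
| impl_c: "f \<in> impl k \<Longrightarrow> c < k \<Longrightarrow> t < k \<Longrightarrow> c \<noteq> t \<Longrightarrow> mcx {c} t \<circ> f \<in> impl k"

lemma impl_comp: "f \<in> impl k \<Longrightarrow> g \<in> impl k \<Longrightarrow> f \<circ> g \<in> impl k"
  by (induction f rule: impl.induct) (auto simp only: id_o comp_assoc intro: impl.intros)

lemma impl_hadamard_op: "q < k \<Longrightarrow> hadamard_op q \<in> impl k"
  using impl_h[OF impl_id] by simp

lemma impl_cx: "c < k \<Longrightarrow> t < k \<Longrightarrow> c \<noteq> t \<Longrightarrow> mcx {c} t \<in> impl k"
  using impl_c[OF impl_id] by simp

lemma impl_phase_op_power: "q < k \<Longrightarrow> phase_op q (zeta 24 ^ j) \<in> impl k"
proof (induction j)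
  case 0
  have "phase_op q 1 = id" by (auto simp: phase_op_def diag_op_def fun_eq_iff)
  then show ?case using impl_id by (simp add: id_def)
next
  case (Suc j)
  have "phase_op q (zeta 24 ^ Suc j) = phase_op q (zeta 24) \<circ> phase_op q (zeta 24 ^ j)"
    by (auto simp: phase_op_def diag_op_def fun_eq_iff)
  then show ?case using impl_t Suc by (simp only:)
qed

section \<open>Roots of unity of order 24 and 8\<close>

lemma zeta_24_power: "zeta 24 ^ j = cis (pi * real j / 12)"
  by (simp add: zeta_def DeMoivre mult.commute)

definition z8 :: complex where "z8 = (1 + \<i>) / complex_of_real (sqrt 2)"

lemma z8_cis: "z8 = cis (pi/4)"
  by (simp add: z8_def complex_eq_iff cos_45 sin_45 real_div_sqrt)

lemma sqrt2_sq [simp]: "complex_of_real (sqrt 2) * complex_of_real (sqrt 2) = 2"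
  "complex_of_real (sqrt 2) * (complex_of_real (sqrt 2) * z) = 2 * z"
  by (simp_all flip: of_real_mult mult.assoc)

lemma z8_sq: "z8 * z8 = \<i>" 
  by (simp add: z8_def field_simps)

lemma z8_eq: "z8 = zeta 24 ^ 3"
  by (simp add: z8_cis zeta_24_power)

lemma impl_phase_op_z8: "q < k \<Longrightarrow> phase_op q (z8 ^ j) \<in> impl k"
  unfolding z8_eq by (simp flip: power_mult add: impl_phase_op_power)

lemma z8_powers: "z8 ^ 2 = \<i>" "z8 ^ 4 = -1" "z8 ^ 6 = -\<i>" "z8 ^ 7 * z8 = 1" "z8 * z8 ^ 7 = 1" "z8^7 * z8^7 = -\<i>"
proof -
  show *: "z8 ^ 2 = \<i>" by (simp add: power2_eq_square z8_sq)
  have "z8 ^ 4 = (z8^2)^2" "z8 ^ 6 = (z8^2)^3" "z8 ^ 7 * z8 = (z8^2)^4" "z8 * z8 ^ 7 = (z8^2)^4" "z8^7 * z8^7 = (z8^2)^7"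
    by (simp_all flip: power_mult power_add power_Suc power_Suc2)
  then show "z8 ^ 4 = -1" "z8 ^ 6 = -\<i>" "z8 ^ 7 * z8 = 1" "z8 * z8 ^ 7 = 1" "z8^7 * z8^7 = -\<i>"
    unfolding * by (simp_all add: eval_nat_numeral)
qed

lemma z8_power_7: "z8 ^ 7 = (1 - \<i>) / complex_of_real (sqrt 2)"
proof -
  have "z8 * z8 ^ 7 = z8 * ((1 - \<i>) / complex_of_real (sqrt 2))"
    unfolding z8_powers by (simp add: z8_def field_simps)
  moreover have "z8 \<noteq> 0" by (simp add: z8_cis)
  ultimately show ?thesis by (metis mult_cancel_left)
qed

lemma i_i [simp]: "\<i> * (\<i> * z) = - z"
  by (simp flip: mult.assoc)

lemma flip_flip [simp]: "flip_bit q (flip_bit q x) = (x::nat)"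
  by (rule bit_eqI) (auto simp: bit_flip_bit_iff)

lemma bit_flip_nat [simp]: "bit (flip_bit q (x::nat)) p \<longleftrightarrow> (if p = q then \<not> bit x q else bit x p)"
  by (auto simp: bit_flip_bit_iff)

lemma flip_swap: "flip_bit p (flip_bit q x) = flip_bit q (flip_bit p (x::nat))"
  by (rule bit_eqI) (auto simp: bit_flip_bit_iff)

text \<open>Off \<open>P\<close> the two Hadamards cancel; on \<open>P\<close> they conjugate
  \<open>w\<close> times Z into \<open>w\<close> times X. The hypothesis says that \<open>P\<close>
  does not read wire \<open>t\<close>, so both values of the target fall into the same case.\<close>

lemma hadamard_op_conj:
  assumes "\<And>x. P (flip_bit t x) = P x"
  shows "hadamard_op t \<circ> diag_op (\<lambda>x. if P x then if bit x t then - w else w else 1) \<circ> hadamard_op t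
    = (\<lambda>\<psi> x. if P x then w * \<psi> (flip_bit t x) else \<psi> x)"
  by (auto simp: fun_eq_iff hadamard_op_def diag_op_def assms field_simps)

section \<open>Multiply controlled gates\<close>

lemma ctl_empty [simp]: "ctl {} x"
  by (simp add: ctl_def)

lemma ctl_insert [simp]: "ctl (insert a A) x \<longleftrightarrow> bit x a \<and> ctl A x"
  by (simp add: ctl_def)

lemma ctl_flip [simp]: "t \<notin> A \<Longrightarrow> ctl A (flip_bit t x) \<longleftrightarrow> ctl A x"
  by (auto simp: ctl_def)

lemma impl_x: assumes "q < k" shows "mcx {} q \<in> impl k"
proof -
  have "mcx {} q = hadamard_op q \<circ> diag_op (\<lambda>x. if True then if bit x q then -1 else 1 else 1) \<circ> hadamard_op q"
    by (subst hadamard_op_conj) (auto simp: perm_op_def mcmap_def)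
  also have "diag_op (\<lambda>x. if True then if bit x q then -1 else 1 else 1) = phase_op q (z8 ^ 4)"
    by (simp add: phase_op_def z8_powers)
  finally show ?thesis using assms by (metis impl_comp impl_hadamard_op impl_phase_op_z8)
qed

text \<open>For bits, a + b - (a xor b) = 2 a b. The inner phase acts on wire \<open>b\<close> while
  it holds the parity of both wires and supplies the negative term; \<open>7 * j\<close> stands for
  \<open>- j\<close> since the eighth power of \<open>z8\<close> is 1.\<close>

lemma impl_cphase:
  assumes "a < k" "b < k" "a \<noteq> b"
  shows "diag_op (\<lambda>x. if bit x a \<and> bit x b then z8 ^ (2 * j) else 1) \<in> impl k"
proof -
  have w: "z8 ^ j * z8 ^ (7 * j) = 1" "z8 ^ (7 * j) * z8 ^ j = 1" "z8 ^ (2 * j) = z8 ^ j * z8 ^ j"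
    by (simp_all add: power_mult z8_powers power2_eq_square z8_sq flip: power_mult_distrib)
  have w': "z8 ^ j * (z8 ^ (7 * j) * y) = y" "z8 ^ (7 * j) * (z8 ^ j * y) = y" for y
    using w(1,2) by (simp_all flip: mult.assoc)
  have "diag_op (\<lambda>x. if bit x a \<and> bit x b then z8 ^ (2 * j) else 1)
     = phase_op a (z8 ^ j) \<circ> (phase_op b (z8 ^ j) \<circ> (mcx {a} b \<circ> (phase_op b (z8 ^ (7 * j)) \<circ> mcx {a} b)))"
    using assms
    by (auto simp: fun_eq_iff phase_op_def diag_op_def perm_op_def mcmap_def w w')
  then show ?thesis using assms by (simp add: impl_comp impl_phase_op_z8 impl_cx)
qed

text \<open>On the target wire this is the commutator \<open>X S X S\<^sup>-\<^sup>1 = \<i> Z\<close>.\<close>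

lemma impl_ciz:
  assumes "mcx A t \<in> impl k" "t \<notin> A" "b \<noteq> t" "b < k" "t < k"
  shows "diag_op (\<lambda>x. if ctl (insert b A) x then if bit x t then - \<i> else \<i> else 1) \<in> impl k"
proof -
  have "diag_op (\<lambda>x. if ctl (insert b A) x then if bit x t then - \<i> else \<i> else 1) =
    mcx A t \<circ> (diag_op (\<lambda>x. if bit x b \<and> bit x t then z8 ^ (2 * 1) else 1) \<circ>
     (mcx A t \<circ> diag_op (\<lambda>x. if bit x b \<and> bit x t then z8 ^ (2 * 3) else 1)))"
    using assms
    by (auto simp: fun_eq_iff diag_op_def perm_op_def mcmap_def z8_powers)
  then show ?thesis using assms by (simp only:) (intro impl_comp impl_cphase)
qed

lemma impl_cix:
  assumes "mcx A t \<in> impl k" "t \<notin> A" "b \<noteq> t" "b < k" "t < k"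
  shows "(\<lambda>\<psi> x. if ctl (insert b A) x then \<i> * \<psi> (flip_bit t x) else \<psi> x) \<in> impl k"
proof -
  have "(\<lambda>\<psi> x. if ctl (insert b A) x then \<i> * \<psi> (flip_bit t x) else \<psi> x)
    = hadamard_op t \<circ> diag_op (\<lambda>x. if ctl (insert b A) x then if bit x t then - \<i> else \<i> else 1) \<circ> hadamard_op t"
    using assms by (subst hadamard_op_conj) auto
  then show ?thesis using assms by (simp only:) (intro impl_comp impl_ciz impl_hadamard_op)
qed

lemma impl_toffoli:
  assumes "a < k" "b < k" "t < k" "a \<noteq> b" "a \<noteq> t" "b \<noteq> t"
  shows "mcx {a, b} t \<in> impl k"
proof -
  \<comment> \<open>The exponent \<open>2 * 3\<close> gives \<open>- \<i>\<close>, which removes the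
    phase \<open>\<i>\<close> that \<open>impl_cix\<close> leaves where both controls hold.\<close>
  have "mcx {a, b} t = diag_op (\<lambda>x. if bit x a \<and> bit x b then z8 ^ (2 * 3) else 1) \<circ>
     (\<lambda>\<psi> x. if ctl {b, a} x then \<i> * \<psi> (flip_bit t x) else \<psi> x)"
    by (auto simp: fun_eq_iff diag_op_def perm_op_def mcmap_def z8_powers)
  also have "\<dots> \<in> impl k"
    using assms by (intro impl_comp impl_cphase impl_cix impl_cx) auto
  finally show ?thesis .
qed

text \<open>Write the control set as \<open>insert b A\<close>. The commutator of \<open>s += \<And>A\<close> and \<open>t += b \<and> s\<close> is
  \<open>t += b \<and> \<And>A\<close>, whatever the value of the spare wire \<open>s\<close>.\<close>

lemma impl_mcx:
  assumes "finite A" "A \<subseteq> {..<k}" "t < k" "t \<notin> A" "s < k" "s \<notin> A" "s \<noteq> t"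
  shows "mcx A t \<in> impl k"
  using assms
proof (induction A arbitrary: s t rule: finite_induct)
  case empty
  then show ?case by (simp add: impl_x)
next
  case (insert b A)
  have "mcx (insert b A) t = mcx {b, s} t \<circ> (mcx A s \<circ> (mcx {b, s} t \<circ> mcx A s))"
    using insert.prems insert.hyps
    by (auto simp: fun_eq_iff perm_op_def mcmap_def flip_swap[of s t])
  moreover have "mcx A s \<in> impl k"
    using insert.prems by (intro insert.IH[where s=t]) auto
  moreover have "mcx {b, s} t \<in> impl k"
    using insert.prems by (intro impl_toffoli) auto
  ultimately show ?case by (simp only: impl_comp)
qed

text \<open>All wires but the target are controls, so no spare wire is left for an exact multiply controlled
  flip. A flip up to the phase \<open>\<i>\<close> suffices, because that phase cancels in \<open>V\<^sup>4\<close>.\<close>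

lemma impl_mcphase:
  assumes "1 \<le> n"
  shows "diag_op (\<lambda>x. if ctl {1..n} x \<longleftrightarrow> \<not> bit x 0 then zeta 24 ^ j else 1) \<in> impl (Suc n)"
proof -
  define V where "V = (\<lambda>(\<psi>::state) x. if ctl (insert n {1..<n}) x then \<i> * \<psi> (flip_bit 0 x) else \<psi> x)"
  have V: "V \<in> impl (Suc n)" unfolding V_def
    \<comment> \<open>Wire \<open>n\<close> is idle in the flip controlled by
      \<open>{1..<n}\<close>, so it is the spare wire there; it then joins as the last
      control.\<close>
    using assms by (intro impl_cix impl_mcx[where s=n]) auto
  have "insert n {1..<n} = {1..n}" using assms by auto
  \<comment> \<open>Where all controls hold, \<open>V\<close> is \<open>\<i>\<close> times X and
    moves the phase from value 1 of wire 0 to value 0; elsewhere \<open>V\<close> is the identity.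
    Hence for wire 0 in state 0 the phase appears exactly when all controls hold.\<close>
  then have "diag_op (\<lambda>x. if ctl {1..n} x \<longleftrightarrow> \<not> bit x 0 then zeta 24 ^ j else 1)
     = V \<circ> (phase_op 0 (zeta 24 ^ j) \<circ> (V \<circ> (V \<circ> V)))"
    by (auto simp: fun_eq_iff V_def phase_op_def diag_op_def algebra_simps)
  then show ?thesis using V by (simp only: impl_comp impl_phase_op_power zero_less_Suc)
qed

text \<open>\<open>H = W X W\<^sup>-\<^sup>1\<close> with \<open>W = S H T\<^sub>8\<close>.\<close>

lemma impl_ch:
  assumes "q < k" "c < k" "c \<noteq> q"
  shows "(\<lambda>\<psi> x. if bit x c then hadamard_op q \<psi> x else \<psi> x) \<in> impl k"
proof -
  have "(\<lambda>\<psi> x. if bit x c then hadamard_op q \<psi> x else \<psi> x) =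
     phase_op q (z8 ^ 2) \<circ> (hadamard_op q \<circ> (phase_op q (z8 ^ 1) \<circ> (mcx {c} q \<circ> (phase_op q (z8 ^ 7) \<circ> (hadamard_op q \<circ> phase_op q (z8 ^ 6))))))"
    (is "?l = ?r")
  proof (intro ext)
    fix \<psi> x
    show "?l \<psi> x = ?r \<psi> x"
      using assms
      by (auto simp: phase_op_def diag_op_def perm_op_def mcmap_def hadamard_op_def z8_powers(1-3) z8_power_7)
         (auto simp: z8_def field_simps)
  qed
  then show ?thesis using assms by (simp only:) (intro impl_comp impl_phase_op_z8 impl_cx impl_hadamard_op)
qed

subsection \<open>One- and two-level operators with one clean ancilla\<close>

text \<open>\<open>lift\<close> adjoins an ancilla in state 0 as the new bit 0.\<close>

definition lift :: "state \<Rightarrow> state" where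
  "lift \<psi> = (\<lambda>x. if even x then \<psi> (x div 2) else 0)"

definition supported :: "nat \<Rightarrow> state \<Rightarrow> bool" where
  "supported N \<psi> \<longleftrightarrow> (\<forall>x\<ge>N. \<psi> x = 0)"

text \<open>Operators act on functions on all of \<open>nat\<close>, so the equation with the
  ancilla is asked for only on functions supported on the register. Demanding that \<open>G\<close>
  keeps this support makes the notion closed under composition.\<close>

definition rep :: "nat \<Rightarrow> (state \<Rightarrow> state) \<Rightarrow> bool" where
  "rep n G \<longleftrightarrow> (\<exists>F\<in>impl (Suc n). \<forall>\<psi>. supported (2^n) \<psi> \<longrightarrow>
     supported (2^n) (G \<psi>) \<and> F (lift \<psi>) = lift (G \<psi>))"

lemma rep_id: "rep n id"
  unfolding rep_def by (rule bexI[OF _ impl_id]) simp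

lemma rep_comp:
  assumes "rep n F" "rep n G"
  shows "rep n (F \<circ> G)"
proof -
  obtain F' where F: "F' \<in> impl (Suc n)" "\<And>\<psi>. supported (2^n) \<psi> \<Longrightarrow>
     supported (2^n) (F \<psi>) \<and> F' (lift \<psi>) = lift (F \<psi>)"
    using assms(1) unfolding rep_def by blast
  obtain G' where G: "G' \<in> impl (Suc n)" "\<And>\<psi>. supported (2^n) \<psi> \<Longrightarrow>
     supported (2^n) (G \<psi>) \<and> G' (lift \<psi>) = lift (G \<psi>)"
    using assms(2) unfolding rep_def by blast
  show ?thesis unfolding rep_def
    using F(2) G(2) by (intro bexI[OF _ impl_comp[OF F(1) G(1)]]) simp
qed

lemma flip_bit_less_iff:
  assumes "t < n" shows "flip_bit t x < 2 ^ n \<longleftrightarrow> x < (2 ^ n :: nat)"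
proof -
  have "take_bit n (flip_bit t x) = flip_bit t (take_bit n x)"
    using assms by (simp add: take_bit_flip_bit_eq)
  then show ?thesis
    by (metis flip_flip take_bit_nat_eq_self_iff)
qed

lemma ctl_Suc: "ctl (Suc ` A) x \<longleftrightarrow> ctl A (x div 2)"
  by (simp add: ctl_def bit_Suc)

lemma rep_mcx:
  assumes "A \<subseteq> {..<n}" "t < n" "t \<notin> A"
  shows "rep n (mcx A t)"
  unfolding rep_def
proof (intro bexI[where x = "mcx (Suc ` A) (Suc t)"] allI impI conjI)
  show "mcx (Suc ` A) (Suc t) \<in> impl (Suc n)"
    \<comment> \<open>Shifting all wires up by one frees wire 0, the ancilla, to serve as spare
      wire.\<close>
    using assms finite_subset[OF assms(1)] by (intro impl_mcx[where s=0]) auto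
  fix \<psi> assume "supported (2^n) \<psi>"
  then show "supported (2^n) (mcx A t \<psi>)"
    using assms unfolding supported_def perm_op_def mcmap_def
    by (metis flip_bit_less_iff linorder_not_le)
  have "lift \<psi> (mcmap (Suc ` A) (Suc t) x) = lift (mcx A t \<psi>) x" for x
    by (auto simp: lift_def perm_op_def mcmap_def ctl_Suc even_flip_bit_iff flip_bit_Suc)
  then show "mcx (Suc ` A) (Suc t) (lift \<psi>) = lift (mcx A t \<psi>)"
    by (simp add: perm_op_def)
qed

text \<open>The bits set in \<open>s\<close> are flipped one at a time. Since these translations act
  transitively on the indices, level operators need explicit circuits only at \<open>mask n\<close>
  and its neighbours.\<close>

lemma rep_xor: 
  assumes "s < 2^n"
  shows "rep n (perm_op (\<lambda>r. xor r s))"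
proof -
  have "i \<le> n \<Longrightarrow> rep n (perm_op (\<lambda>r. xor r (take_bit i s)))" for i
  proof (induction i)
    case 0
    have "perm_op (\<lambda>r. xor r (take_bit 0 s)) = id" by (auto simp: perm_op_def fun_eq_iff)
    then show ?case by (simp only: rep_id)
  next
    case (Suc i)
    show ?case
    proof (cases "bit s i")
      case True
      then have *: "xor r (take_bit (Suc i) s) = flip_bit i (xor r (take_bit i s))" for r
        by (intro bit_eqI) (auto simp: bit_simps less_Suc_eq)
      have "perm_op (\<lambda>r. xor r (take_bit (Suc i) s)) = perm_op (\<lambda>r. xor r (take_bit i s)) \<circ> mcx {} i"
        unfolding * by (auto simp: perm_op_def fun_eq_iff mcmap_def flip_bit_eq_xor ac_simps)
      then show ?thesis
        using Suc by (simp only:) (intro rep_comp rep_mcx, auto)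
    next
      case False
      then have "take_bit (Suc i) s = take_bit i s"
        by (intro bit_eqI) (auto simp: bit_simps less_Suc_eq)
      then show ?thesis using Suc by simp
    qed
  qed
  from this[of n] assms show ?thesis by (simp add: take_bit_nat_eq_self)
qed

definition level_phase :: "nat \<Rightarrow> complex \<Rightarrow> state \<Rightarrow> state" where
  "level_phase j z \<psi> = \<psi>(j := z * \<psi> j)"

text \<open>This is a two-level Hadamard times \<open>z8 ^ 7\<close>. The phase replaces the divisor
  sqrt 2 by \<open>1 + \<i>\<close>, so that the matrix is still unitary but has entries generated
  by 1/2 and \<open>\<i>\<close>.\<close>

definition level_mix :: "nat \<Rightarrow> nat \<Rightarrow> state \<Rightarrow> state" where
  "level_mix j l \<psi> = \<psi>(j := (\<psi> j + \<psi> l) / (1 + \<i>), l := (\<psi> j - \<psi> l) / (1 + \<i>))"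

lemma level_phase_conj:
  assumes "\<And>x. f (f x) = x"
  shows "perm_op f \<circ> (level_phase j z \<circ> perm_op f) = level_phase (f j) z"
proof -
  have "f x = j \<longleftrightarrow> x = f j" for x using assms by metis
  then show ?thesis by (auto simp: fun_eq_iff perm_op_def level_phase_def assms)
qed

lemma level_mix_conj:
  assumes "\<And>x. f (f x) = x"
  shows "perm_op f \<circ> (level_mix j l \<circ> perm_op f) = level_mix (f j) (f l)"
proof -
  have "f x = j \<longleftrightarrow> x = f j" "f x = l \<longleftrightarrow> x = f l" for x using assms by metis+
  then show ?thesis by (auto simp: fun_eq_iff perm_op_def level_mix_def assms)
qed

lemma ctl_mask:
  assumes "r < 2 ^ n" shows "ctl {..<n} r \<longleftrightarrow> r = mask n"
proof
  assume "ctl {..<n} r"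
  moreover have "\<not> bit r i" if "n \<le> i" for i
    using assms that by (metis bit_take_bit_iff linorder_not_le take_bit_nat_eq_self)
  ultimately show "r = mask n"
    by (intro bit_eqI) (auto simp: ctl_def bit_mask_iff not_less[symmetric])
qed (simp add: ctl_def bit_mask_iff)

lemma Suc_lessThan: "{1..n} = Suc ` {..<n}"
  by (rule image_Suc_lessThan[symmetric])

text \<open>With the ancilla in state 0, the condition in \<open>impl_mcphase\<close> says that all
  register bits are 1, which for an index below \<open>2 ^ n\<close> means
  \<open>mask n\<close>.\<close>

lemma rep_level_phase_mask:
  assumes "1 \<le> n"
  shows "rep n (level_phase (mask n) (zeta 24 ^ p))"
  unfolding rep_def
proof (rule bexI[OF _ impl_mcphase[OF assms, of p]], intro allI impI conjI)
  fix \<psi> assume s: "supported (2^n) \<psi>"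
  then show "supported (2^n) (level_phase (mask n) (zeta 24 ^ p) \<psi>)"
    by (auto simp: supported_def level_phase_def)
  show "diag_op (\<lambda>x. if ctl {1..n} x = (\<not> bit x 0) then zeta 24 ^ p else 1) (lift \<psi>) =
         lift (level_phase (mask n) (zeta 24 ^ p) \<psi>)" (is "?l = ?r")
  proof
    fix x
    show "?l x = ?r x"
    proof (cases "x div 2 < 2 ^ n")
      case True
      then show ?thesis
        using ctl_mask[OF True] unfolding Suc_lessThan ctl_Suc
        by (auto simp: diag_op_def lift_def level_phase_def bit_0)
    next
      case False
      then have "\<psi> (x div 2) = 0" using s by (simp add: supported_def)
      then show ?thesis by (auto simp: diag_op_def lift_def level_phase_def)
    qed
  qed
qed

lemma rep_level_phase:
  assumes "1 \<le> n" "j < 2 ^ n"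
  shows "rep n (level_phase j (zeta 24 ^ p))"
proof -
  let ?f = "\<lambda>r. xor r (xor j (mask n))"
  have "xor j (mask n) < 2 ^ n"
    using assms by (intro take_bit_nat_eq_self_iff[THEN iffD1]) (simp add: take_bit_nat_eq_self)
  then have "rep n (perm_op ?f \<circ> (level_phase (mask n) (zeta 24 ^ p) \<circ> perm_op ?f))"
    using assms by (intro rep_comp rep_level_phase_mask rep_xor) auto
  moreover have "?f (?f x) = x" for x
    by (intro bit_eqI) (auto simp: bit_simps)
  moreover have "?f (mask n) = j"
    by (intro bit_eqI) (auto simp: bit_simps)
  ultimately show ?thesis by (simp only: level_phase_conj)
qed

lemma flip_Suc_div: "flip_bit (Suc q) x div 2 = flip_bit q (x div 2)" for x :: nat
  by (simp add: flip_bit_Suc)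

lemma inv_1i: "z / (1 + \<i>) = (1 - \<i>) * z / 2"
proof -
  have "1 + \<i> \<noteq> 0" by (simp add: complex_eq_iff)
  moreover have "z * 2 = (1 - \<i>) * z * (1 + \<i>)" by (simp add: algebra_simps)
  ultimately show ?thesis by (metis frac_eq_eq zero_neq_numeral)
qed

text \<open>The ancilla receives the conjunction of all bits except \<open>q\<close>, controls a
  Hadamard on \<open>q\<close> and is then reset. The phase \<open>z8 ^ 7\<close> on the ancilla
  changes the factor 1/sqrt 2 into \<open>1/(1 + \<i>)\<close>. The conjunction holds in the
  register at precisely the two levels to be mixed.\<close>

lemma rep_level_mix_mask:
  assumes "q < n"
  shows "rep n (level_mix (flip_bit q (mask n)) (mask n))"
proof -
  define A where "A = Suc ` ({..<n} - {q})"
  have A: "Suc q \<notin> A" "0 \<notin> A" "A \<subseteq> {..<Suc n}" "finite A" by (auto simp: A_def)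
  let ?C = "\<lambda>\<psi> x. if bit x 0 then hadamard_op (Suc q) \<psi> x else \<psi> x"
  define F where "F = mcx A 0 \<circ> (phase_op 0 (z8 ^ 7) \<circ> (?C \<circ> mcx A 0))"
  have "F \<in> impl (Suc n)" unfolding F_def
    \<comment> \<open>The wire of bit \<open>q\<close> is not among the controls \<open>A\<close>,
      so it can be the spare wire.\<close>
    using assms A by (intro impl_comp impl_mcx[where s="Suc q"] impl_phase_op_z8 impl_ch) auto
  moreover have "supported (2^n) (level_mix (flip_bit q (mask n)) (mask n) \<psi>) \<and>
       F (lift \<psi>) = lift (level_mix (flip_bit q (mask n)) (mask n) \<psi>)" if s: "supported (2^n) \<psi>" for \<psi>
  proof
    have lt: "flip_bit q (mask n) < (2 ^ n :: nat)" "mask n < (2 ^ n :: nat)"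
      using assms by (simp_all add: flip_bit_less_iff)
    show "supported (2^n) (level_mix (flip_bit q (mask n)) (mask n) \<psi>)"
      using s lt by (simp add: supported_def level_mix_def not_le[symmetric])
    show "F (lift \<psi>) = lift (level_mix (flip_bit q (mask n)) (mask n) \<psi>)"
    proof
      fix x
      have F: "F (lift \<psi>) x = (if even x \<and> ctl ({..<n} - {q}) (x div 2)
         then ((if bit (x div 2) q then - \<psi> (x div 2) else \<psi> (x div 2)) + \<psi> (flip_bit q (x div 2))) / (1 + \<i>)
         else lift \<psi> x)"
      proof -
        have c: "ctl A x = ctl ({..<n} - {q}) (x div 2)" unfolding A_def by (rule ctl_Suc)
        have d: "z8 ^ 7 * y / complex_of_real (sqrt 2) = y / (1 + \<i>)" for y
          by (simp add: z8_power_7 inv_1i)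
        have e: "even (flip_bit (Suc q) x) = even x" "bit x (Suc q) = bit (x div 2) q"
          by (simp_all add: even_flip_bit_iff bit_Suc)
        show ?thesis
          unfolding c[symmetric] using A(1,2)
          by (cases "even x"; cases "ctl A x"; cases "bit (x div 2) q")
             (simp_all add: F_def perm_op_def mcmap_def phase_op_def diag_op_def hadamard_op_def flip_swap[of "Suc q" 0]
               d e lift_def bit_0 flip_Suc_div even_flip_bit_iff)
      qed
      have fm: "y = flip_bit q z \<longleftrightarrow> flip_bit q y = z" for y z :: nat by auto
      show "F (lift \<psi>) x = lift (level_mix (flip_bit q (mask n)) (mask n) \<psi>) x"
      proof (cases "x div 2 < 2 ^ n")
        case True
        then have "flip_bit q (x div 2) < 2 ^ n" using assms by (simp add: flip_bit_less_iff)
        note m = ctl_mask[OF True] ctl_mask[OF this]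
        have "{..<n} = insert q ({..<n} - {q})" using assms by auto
        then have "ctl {..<n} y = (bit y q \<and> ctl ({..<n} - {q}) y)" for y
          by (metis ctl_insert)
        then have m': "x div 2 = mask n \<longleftrightarrow> bit (x div 2) q \<and> ctl ({..<n} - {q}) (x div 2)"
          "x div 2 = flip_bit q (mask n) \<longleftrightarrow> \<not> bit (x div 2) q \<and> ctl ({..<n} - {q}) (x div 2)"
          using m by (auto simp: fm)
        show ?thesis unfolding F
          using m' by (auto simp: lift_def level_mix_def fun_upd_def)
      next
        case False
        then have "\<psi> (x div 2) = 0" "\<psi> (flip_bit q (x div 2)) = 0"
          using s assms by (simp_all add: supported_def flip_bit_less_iff flip: not_less)
        moreover have "x div 2 \<noteq> mask n" "x div 2 \<noteq> flip_bit q (mask n)" using False lt by auto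
        ultimately show ?thesis unfolding F by (auto simp: lift_def level_mix_def)
      qed
    qed
  qed
  ultimately show ?thesis unfolding rep_def by blast
qed

lemma rep_level_mix_flip:
  assumes "q < n" "j < 2 ^ n"
  shows "rep n (level_mix j (flip_bit q j))"
proof -
  let ?s = "xor j (flip_bit q (mask n))"
  let ?f = "\<lambda>r. xor r ?s"
  have "flip_bit q (mask n) < (2::nat) ^ n" using assms by (simp add: flip_bit_less_iff)
  then have "?s < 2 ^ n"
    using assms by (intro take_bit_nat_eq_self_iff[THEN iffD1]) (simp add: take_bit_nat_eq_self)
  then have "rep n (perm_op ?f \<circ> (level_mix (flip_bit q (mask n)) (mask n) \<circ> perm_op ?f))"
    using assms by (intro rep_comp rep_level_mix_mask rep_xor) auto
  moreover have "?f (?f x) = x" for x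
    by (intro bit_eqI) (auto simp: bit_simps)
  moreover have "?f (flip_bit q (mask n)) = j" "?f (mask n) = flip_bit q j"
    by (intro bit_eqI; auto simp: bit_simps)+
  ultimately show ?thesis by (simp only: level_mix_conj)
qed

lemma bit_less_nat: "bit x q \<Longrightarrow> x < 2 ^ n \<Longrightarrow> q < (n::nat)" for x :: nat
  by (metis bit_take_bit_iff take_bit_nat_eq_self)

text \<open>Conjugation by a controlled-not from one differing bit onto another brings the two levels closer.\<close>

lemma rep_level_mix:
  assumes "j < 2 ^ n" "l < 2 ^ n" "j \<noteq> l"
  shows "rep n (level_mix j l)"
  using assms
proof (induction "card {q. bit j q \<noteq> bit l q}" arbitrary: j l rule: less_induct)
  case less
  have sub: "{q. bit j q \<noteq> bit l q} \<subseteq> {..<n}"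
    using bit_less_nat less.prems by blast
  then have fin: "finite {q. bit j q \<noteq> bit l q}" by (rule finite_subset) simp
  obtain q where q: "bit j q \<noteq> bit l q" using less.prems(3) by (metis bit_eqI)
  show ?case
  proof (cases "\<exists>p. p \<noteq> q \<and> bit j p \<noteq> bit l p")
    case False
    then have "l = flip_bit q j" using q by (intro bit_eqI) auto
    moreover have "q < n" using q sub by blast
    ultimately show ?thesis using rep_level_mix_flip less.prems by simp
  next
    case True
    then obtain p where p: "p \<noteq> q" "bit j p \<noteq> bit l p" by blast
    let ?f = "mcmap {q} p"
    have lt: "q < n" "p < n" using q p sub by auto
    have inv: "?f (?f x) = x" for x using p by (auto simp: mcmap_def)
    have "{r. bit (?f j) r \<noteq> bit (?f l) r} \<subset> {r. bit j r \<noteq> bit l r}"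
      using p q by (auto simp: mcmap_def split: if_splits)
    then have "card {r. bit (?f j) r \<noteq> bit (?f l) r} < card {r. bit j r \<noteq> bit l r}"
      by (rule psubset_card_mono[OF fin])
    moreover have "?f j < 2 ^ n" "?f l < 2 ^ n"
      using less.prems lt by (simp_all add: mcmap_def flip_bit_less_iff)
    moreover have "?f j \<noteq> ?f l"
      using less.prems(3) inv[of j] inv[of l] by metis
    ultimately have "rep n (level_mix (?f j) (?f l))" using less.hyps by blast
    then have "rep n (perm_op ?f \<circ> (level_mix (?f j) (?f l) \<circ> perm_op ?f))"
      using lt p by (intro rep_comp rep_mcx) auto
    then show ?thesis by (simp only: level_mix_conj inv)
  qed
qed

subsection \<open>Arithmetic of the twelfth cyclotomic integers\<close>

definition omega :: complex where "omega = Complex (-1/2) (sqrt 3 / 2)"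

lemma omega_sq: "omega * omega = - 1 - omega"
  by (simp add: omega_def complex_eq_iff field_simps)

lemma omega_sq': "omega * (omega * z) = - z - omega * z"
  by (simp only: mult.assoc[symmetric] omega_sq) (simp add: algebra_simps)

type_synonym quad = "int \<times> int \<times> int \<times> int"

text \<open>The quadruple holds coordinates in the basis 1, i, omega, i omega of the ring generated
  by a twelfth root of unity, where \<open>omega\<close> is a primitive cube root of unity.\<close>

fun ev :: "quad \<Rightarrow> complex" where
  "ev (a, b, c, d) = of_int a + of_int b * \<i> + of_int c * omega + of_int d * \<i> * omega"

text \<open>Put alpha = a + c omega and beta = b + d omega. The absolute square of alpha + i beta is
  |alpha|^2 + |beta|^2 - 2 Im(cnj alpha * beta). The first two terms make up
  \<open>norm_int\<close>, the last is \<open>norm_sqrt3\<close> times sqrt 3.\<close>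

fun norm_int :: "quad \<Rightarrow> int" where
  "norm_int (a, b, c, d) = a\<^sup>2 - a * c + c\<^sup>2 + (b\<^sup>2 - b * d + d\<^sup>2)"

fun norm_sqrt3 :: "quad \<Rightarrow> int" where
  "norm_sqrt3 (a, b, c, d) = b * c - a * d"

lemma ev_norm: "cnj (ev w) * ev w = complex_of_real (of_int (norm_int w) + of_int (norm_sqrt3 w) * sqrt 3)"
proof (cases w)
  case (fields a b c d)
  have [simp]: "sqrt 3 * (sqrt 3 * x) = 3 * x" for x by (simp flip: mult.assoc)
  show ?thesis
    by (simp add: fields omega_def complex_eq_iff power2_eq_square algebra_simps)
qed

lemma ev_0 [simp]: "ev (0, 0, 0, 0) = 0"
  by simp

lemma ev_int: "\<exists>w. ev w = of_int x"
  by (rule exI[of _ "(x, 0, 0, 0)"]) simp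

lemma ev_add: "\<exists>w. ev w = ev u + ev v"
proof (cases u, cases v)
  fix a b c d a' b' c' d' assume "u = (a, b, c, d)" "v = (a', b', c', d')"
  then have "ev (a + a', b + b', c + c', d + d') = ev u + ev v" by (simp add: algebra_simps)
  then show ?thesis by blast
qed

lemma ev_mult: "\<exists>w. ev w = ev u * ev v"
proof (cases u, cases v)
  fix a b c d a' b' c' d' assume "u = (a, b, c, d)" "v = (a', b', c', d')"
  then have "ev (a*a' - b*b' - (c*c' - d*d'), a*b' + b*a' - (c*d' + d*c'),
      a*c' - b*d' + (c*a' - d*b') - (c*c' - d*d'), a*d' + b*c' + (c*b' + d*a') - (c*d' + d*c')) = ev u * ev v"
    by (simp add: algebra_simps omega_sq omega_sq')
  then show ?thesis by blast
qed

lemma ev_cnj: "\<exists>w. ev w = cnj (ev u)"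
proof (cases u)
  case (fields a b c d)
  have *: "cnj omega = - 1 - omega" by (simp add: omega_def complex_eq_iff)
  have "ev (a - c, d - b, - c, d) = cnj (ev u)"
    unfolding fields by (simp add: * algebra_simps)
  then show ?thesis by blast
qed

lemma ev_power: "\<exists>w. ev w = ev u ^ k"
proof (induction k)
  case 0 then show ?case using ev_int[of 1] by simp
next
  case (Suc k) then show ?case using ev_mult by (metis power_Suc)
qed

section \<open>Linear independence of square roots over the integers\<close>

lemma int_square_quotient:
  fixes x y n :: int
  assumes "x\<^sup>2 = n * y\<^sup>2" "y \<noteq> 0" shows "\<exists>z. n = z\<^sup>2"
proof -
  have "y\<^sup>2 dvd x\<^sup>2" using assms by simp
  then have "y dvd x" by simp
  then obtain z where "x = y * z" by auto
  then show ?thesis using assms by (auto simp: power_mult_distrib)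
qed

lemma non_squares:
  fixes z :: int shows "z\<^sup>2 \<noteq> 2" "z\<^sup>2 \<noteq> 3" "z\<^sup>2 \<noteq> 6"
proof -
  have "\<bar>z\<bar> \<le> 1 \<or> \<bar>z\<bar> = 2 \<or> 3 \<le> \<bar>z\<bar>" by linarith
  then have "\<bar>z\<bar>\<^sup>2 \<le> 1 \<or> \<bar>z\<bar>\<^sup>2 = 4 \<or> 9 \<le> \<bar>z\<bar>\<^sup>2"
  proof (elim disjE)
    assume "\<bar>z\<bar> = 2" then have "\<bar>z\<bar>\<^sup>2 = 4" by (simp only:) simp
    then show ?thesis by blast
  qed (use power_mono[of "\<bar>z\<bar>" 1 2] power_mono[of 3 "\<bar>z\<bar>" 2] in auto)
  then show "z\<^sup>2 \<noteq> 2" "z\<^sup>2 \<noteq> 3" "z\<^sup>2 \<noteq> 6" by auto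
qed

lemma int_sqrt_indep:
  fixes x y n :: int
  assumes "x\<^sup>2 = n * y\<^sup>2" "\<And>z. z\<^sup>2 \<noteq> n" shows "x = 0 \<and> y = 0"
  using int_square_quotient[OF assms(1)] assms by (cases "y = 0") auto

lemma sqrt3_indep:
  fixes p q :: int
  assumes "of_int p + of_int q * sqrt 3 = (0::real)"
  shows "p = 0 \<and> q = 0"
proof -
  have "of_int p = - (of_int q * sqrt 3)" using assms by simp
  then have "(of_int p)\<^sup>2 = (of_int q * sqrt 3)\<^sup>2" by simp
  also have "\<dots> = of_int (3 * q\<^sup>2)" by (simp add: power_mult_distrib)
  finally have "real_of_int (p\<^sup>2) = of_int (3 * q\<^sup>2)" by simp
  then have "p\<^sup>2 = 3 * q\<^sup>2" by (simp only: of_int_eq_iff)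
  then show ?thesis using int_sqrt_indep non_squares by blast
qed

text \<open>Squaring and comparing coefficients gives two integer equations. They make the norms r^2
  - 3 s^2 and 2 p^2 - 6 q^2 equal up to sign, and either sign makes 2 or 6 a quotient of squares
  unless all four integers vanish.\<close>

lemma sqrt2_indep:
  fixes p q r s :: int
  assumes "sqrt 2 * (of_int p + of_int q * sqrt 3) = of_int r + of_int s * sqrt 3"
  shows "p = 0 \<and> q = 0 \<and> r = 0 \<and> s = 0"
proof -
  have s2: "sqrt 2 * (sqrt 2 * x) = 2 * x" for x by (simp flip: mult.assoc)
  have "(sqrt 2 * (of_int p + of_int q * sqrt 3))\<^sup>2 = (of_int r + of_int s * sqrt 3)\<^sup>2"
    using assms by simp
  then have "of_int (2 * p\<^sup>2 + 6 * q\<^sup>2 - r\<^sup>2 - 3 * s\<^sup>2) + of_int (4 * p * q - 2 * r * s) * sqrt 3 = (0::real)"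
    by (simp add: power_mult_distrib power2_sum algebra_simps s2)
  then have e: "2 * p\<^sup>2 + 6 * q\<^sup>2 - r\<^sup>2 - 3 * s\<^sup>2 = 0" "4 * p * q - 2 * r * s = 0"
    using sqrt3_indep by blast+
  have "(r\<^sup>2 - 3 * s\<^sup>2)\<^sup>2 = (r\<^sup>2 + 3 * s\<^sup>2)\<^sup>2 - 3 * (2 * r * s)\<^sup>2"
    by (simp add: power2_eq_square algebra_simps)
  also have "\<dots> = (2 * p\<^sup>2 + 6 * q\<^sup>2)\<^sup>2 - 3 * (4 * p * q)\<^sup>2"
  proof -
    have "r\<^sup>2 + 3 * s\<^sup>2 = 2 * p\<^sup>2 + 6 * q\<^sup>2" "2 * r * s = 4 * p * q" using e by auto
    then show ?thesis by (simp only:)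
  qed
  also have "\<dots> = (2 * p\<^sup>2 - 6 * q\<^sup>2)\<^sup>2"
    by (simp add: power2_eq_square algebra_simps)
  finally have "r\<^sup>2 - 3 * s\<^sup>2 = 2 * p\<^sup>2 - 6 * q\<^sup>2 \<or> r\<^sup>2 - 3 * s\<^sup>2 = - (2 * p\<^sup>2 - 6 * q\<^sup>2)"
    by (simp add: power2_eq_iff)
  \<comment> \<open>With the minus sign the second equation is 3 s^2 = 2 p^2; multiplying it by 3
    gives the shape required by \<open>int_sqrt_indep\<close>.\<close>
  then have "r\<^sup>2 = 2 * p\<^sup>2 \<and> s\<^sup>2 = 2 * q\<^sup>2 \<or> r\<^sup>2 = 6 * q\<^sup>2 \<and> (3 * s)\<^sup>2 = 6 * p\<^sup>2"
    using e(1) by (auto simp: power_mult_distrib)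
  then show ?thesis using int_sqrt_indep non_squares by fastforce
qed

text \<open>Since sqrt 2 times \<open>z8\<close> is \<open>1 + \<i>\<close>, multiplying by sqrt 2
  turns the relation into sqrt 2 \<open>ev u\<close> = \<open>ev x\<close>. Twice the real and twice
  the imaginary part of an \<open>ev\<close> value are integer combinations of 1 and sqrt 3, so
  \<open>sqrt2_indep\<close> applies to each.\<close>

lemma ev_z8_indep:
  assumes "ev u + z8 * ev v = 0" shows "ev u = 0 \<and> ev v = 0"
proof -
  obtain x where x: "ev x = - (1 + \<i>) * ev v"
    using ev_mult[of "(-1,-1,0,0)" v] by auto
  have "complex_of_real (sqrt 2) * (ev u + z8 * ev v) = 0" using assms by simp
  moreover have "complex_of_real (sqrt 2) * (z8 * ev v) = - ev x"
    unfolding x by (simp add: z8_def) (simp add: algebra_simps)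
  ultimately have eq: "complex_of_real (sqrt 2) * ev u = ev x"
    by (simp add: distrib_left)
  obtain a b c d where u: "u = (a, b, c, d)" by (cases u)
  obtain a' b' c' d' where x': "x = (a', b', c', d')" by (cases x)
  have "sqrt 2 * (of_int (2 * a - c) + of_int (- d) * sqrt 3) = of_int (2 * a' - c') + of_int (- d') * sqrt 3"
    using arg_cong[OF eq, of "\<lambda>z. 2 * Re z"] by (simp add: u x' omega_def algebra_simps)
  moreover have "sqrt 2 * (of_int (2 * b - d) + of_int c * sqrt 3) = of_int (2 * b' - d') + of_int c' * sqrt 3"
    using arg_cong[OF eq, of "\<lambda>z. 2 * Im z"] by (simp add: u x' omega_def algebra_simps)
  ultimately have "u = (0, 0, 0, 0)" "x = (0, 0, 0, 0)"
    using sqrt2_indep[of "2 * a - c" "- d" "2 * a' - c'" "- d'"] sqrt2_indep[of "2 * b - d" c "2 * b' - d'" c']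
    unfolding u x' by simp_all
  moreover have "1 + \<i> \<noteq> 0" by (simp add: complex_eq_iff)
  ultimately show ?thesis using x by (auto simp: add_eq_0_iff)
qed

section \<open>Twelfth roots of unity and elements of small norm\<close>

lemma zeta12_eq: "zeta 12 = - \<i> * omega"
  by (simp add: zeta_def omega_def complex_eq_iff cos_30 sin_30)

lemma zeta12_powers:
  "zeta 12 ^ 2 = 1 + omega" "zeta 12 ^ 3 = \<i>" "zeta 12 ^ 4 = omega" "zeta 12 ^ 5 = \<i> * (1 + omega)"
  "zeta 12 ^ 6 = - 1" "zeta 12 ^ 7 = \<i> * omega" "zeta 12 ^ 8 = - 1 - omega" "zeta 12 ^ 9 = - \<i>"
  "zeta 12 ^ 10 = - omega" "zeta 12 ^ 11 = \<i> * (- 1 - omega)" "zeta 12 ^ 12 = 1"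
proof -
  show 2: "zeta 12 ^ 2 = 1 + omega"
    by (simp add: zeta12_eq power2_eq_square omega_sq omega_sq' algebra_simps)
  have "zeta 12 ^ 3 = zeta 12 * zeta 12 ^ 2" by (simp add: eval_nat_numeral)
  also have "\<dots> = \<i>" unfolding 2 by (simp add: zeta12_eq omega_sq omega_sq' algebra_simps)
  finally show 3: "zeta 12 ^ 3 = \<i>" .
  have e: "zeta 12 ^ 4 = zeta 12 ^ 2 * zeta 12 ^ 2" "zeta 12 ^ 5 = zeta 12 ^ 3 * zeta 12 ^ 2"
    "zeta 12 ^ 6 = zeta 12 ^ 3 * zeta 12 ^ 3" "zeta 12 ^ 7 = zeta 12 ^ 4 * zeta 12 ^ 3"
    "zeta 12 ^ 8 = zeta 12 ^ 4 * zeta 12 ^ 4" "zeta 12 ^ 9 = zeta 12 ^ 6 * zeta 12 ^ 3"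
    "zeta 12 ^ 10 = zeta 12 ^ 6 * zeta 12 ^ 4" "zeta 12 ^ 11 = zeta 12 ^ 8 * zeta 12 ^ 3"
    "zeta 12 ^ 12 = zeta 12 ^ 6 * zeta 12 ^ 6"
    by (simp_all flip: power_add)
  show 4: "zeta 12 ^ 4 = omega" unfolding e 2 by (simp add: omega_sq algebra_simps)
  show 6: "zeta 12 ^ 6 = - 1" unfolding e 3 by simp
  show 8: "zeta 12 ^ 8 = - 1 - omega" unfolding e(5) 4 by (simp add: omega_sq)
  show "zeta 12 ^ 5 = \<i> * (1 + omega)" unfolding e(2) 2 3 ..
  show "zeta 12 ^ 7 = \<i> * omega" unfolding e(4) 3 4 by simp
  show "zeta 12 ^ 9 = - \<i>" unfolding e(6) 6 3 by simp
  show "zeta 12 ^ 10 = - omega" unfolding e(7) 6 4 by simp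
  show "zeta 12 ^ 11 = \<i> * (- 1 - omega)" unfolding e(8) 8 3 by simp
  show "zeta 12 ^ 12 = 1" unfolding e(9) 6 by simp
qed

lemma eisenstein_nonneg: "0 \<le> a\<^sup>2 - a * c + (c\<^sup>2 :: int)"
proof -
  have "4 * (a\<^sup>2 - a * c + c\<^sup>2) = (2 * a - c)\<^sup>2 + 3 * c\<^sup>2"
    by (simp add: power2_eq_square algebra_simps)
  also have "\<dots> \<ge> 0" by simp
  finally show ?thesis by simp
qed

lemma eisenstein_small: 
  assumes "a\<^sup>2 - a * c + c\<^sup>2 \<le> (1::int)" shows "\<bar>c\<bar> \<le> 1"
proof (rule ccontr)
  assume "\<not> \<bar>c\<bar> \<le> 1"
  then have "2 * 2 \<le> \<bar>c\<bar> * \<bar>c\<bar>" by (intro mult_mono) auto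
  then have "4 \<le> c\<^sup>2" by (simp add: power2_eq_square)
  moreover have "(2 * a - c)\<^sup>2 + 3 * c\<^sup>2 \<le> 4"
  proof -
    have "(2 * a - c)\<^sup>2 + 3 * c\<^sup>2 = 4 * (a\<^sup>2 - a * c + c\<^sup>2)"
      by (simp add: power2_eq_square algebra_simps)
    also have "\<dots> \<le> 4 * 1" using assms by (intro mult_left_mono) auto
    finally show ?thesis by simp
  qed
  moreover have "0 \<le> (2 * a - c)\<^sup>2" by (rule zero_le_power2)
  ultimately show False by (smt (verit))
qed

lemma norm_int_nonneg: "0 \<le> norm_int w"
  by (cases w) (simp add: eisenstein_nonneg add_nonneg_nonneg)

lemma norm_int_small:
  assumes "norm_int (a, b, c, d) \<le> 1"
  shows "a \<in> {-1,0,1}" "b \<in> {-1,0,1}" "c \<in> {-1,0,1}" "d \<in> {-1,0,1}"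
proof -
  have "a\<^sup>2 - a * c + c\<^sup>2 \<le> 1" "b\<^sup>2 - b * d + d\<^sup>2 \<le> 1"
    using assms eisenstein_nonneg[of a c] eisenstein_nonneg[of b d] by auto
  moreover from this have "c\<^sup>2 - c * a + a\<^sup>2 \<le> 1" "d\<^sup>2 - d * b + b\<^sup>2 \<le> 1" by (simp_all add: ac_simps)
  ultimately have "\<bar>c\<bar> \<le> 1" "\<bar>d\<bar> \<le> 1" "\<bar>a\<bar> \<le> 1" "\<bar>b\<bar> \<le> 1" by (auto intro: eisenstein_small)
  then show "a \<in> {-1,0,1}" "b \<in> {-1,0,1}" "c \<in> {-1,0,1}" "d \<in> {-1,0,1}" by auto
qed

lemma norm_int_eq_0: "norm_int w = 0 \<Longrightarrow> w = (0, 0, 0, 0)"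
proof (cases w)
  case (fields a b c d)
  assume "norm_int w = 0"
  with fields norm_int_small[of a b c d] show ?thesis by auto
qed

text \<open>All coordinates lie in {-1, 0, 1}, and the quadruples with norm 1 among these are the
  twelve roots of unity. The exponent \<open>p\<close> is that of the inverse root.\<close>

lemma norm_int_eq_1:
  assumes "norm_int w = 1" shows "\<exists>p. zeta 12 ^ p * ev w = 1"
proof -
  obtain a b c d where w: "w = (a, b, c, d)" by (cases w)
  have "\<exists>q\<le>12. ev w = zeta 12 ^ q"
  proof -
    have "w \<in> {(1,0,0,0), (0,0,1,0), (-1,0,-1,0), (0,1,0,0), (0,0,0,1), (0,-1,0,-1), (-1,0,0,0),
       (0,0,-1,0), (1,0,1,0), (0,-1,0,0), (0,0,0,-1), (0,1,0,1)}"
    proof -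
      have n: "norm_int (a, b, c, d) = 1" using assms w by simp
      then have "a \<in> {-1,0,1}" "b \<in> {-1,0,1}" "c \<in> {-1,0,1}" "d \<in> {-1,0,1}"
        using norm_int_small[of a b c d] by (simp_all del: norm_int.simps)
      then show ?thesis unfolding w by (elim insertE emptyE; use n in simp)
    qed
    \<comment> \<open>The exponents are listed in the order of the quadruples above.\<close>
    then have "ev w \<in> (\<lambda>q. zeta 12 ^ q) ` {0, 4, 8, 3, 7, 11, 6, 10, 2, 9, 1, 5}"
      unfolding image_insert zeta12_powers by (elim insertE emptyE) (simp_all add: zeta12_eq algebra_simps)
    then obtain q where "q \<in> {0, 4, 8, 3, 7, 11, 6, 10, 2, 9, 1, 5}" "ev w = zeta 12 ^ q"
      by (rule imageE)
    moreover from this(1) have "q \<le> 12" by (elim insertE emptyE) simp_all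
    ultimately show ?thesis by blast
  qed
  then obtain q where "q \<le> 12" "ev w = zeta 12 ^ q" by blast
  then have "zeta 12 ^ (12 - q) * ev w = 1"
    by (simp add: zeta12_powers flip: power_add)
  then show ?thesis by blast
qed

text \<open>There are six odd residue classes modulo 2 of each of the two types, and the roots of unity
  \<open>\<i>\<^sup>b \<omega>\<^sup>a\<close> permute each type transitively.\<close>

lemma same_type_congruent:
  assumes "odd (norm_int u) \<and> odd (norm_int v) \<or> odd (norm_sqrt3 u) \<and> odd (norm_sqrt3 v)"
  shows "\<exists>p z. ev u - zeta 12 ^ p * ev v = 2 * ev z"
proof -
  obtain a b c d where u: "u = (a, b, c, d)" by (cases u)
  obtain a' b' c' d' where v: "v = (a', b', c', d')" by (cases v)
  have *: "\<exists>p z. ev u - zeta 12 ^ p * ev v = 2 * ev z"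
    if e: "even (a - x)" "even (b - y)" "even (c - s)" "even (d - t)" and eq: "ev (x, y, s, t) = zeta 12 ^ p * ev v"
    for x y s t p
  proof -
    have "ev u - zeta 12 ^ p * ev v = of_int (a - x) + of_int (b - y) * \<i> + of_int (c - s) * omega + of_int (d - t) * \<i> * omega"
      using eq[symmetric] by (simp add: u algebra_simps)
    moreover obtain x' y' s' t' where "a - x = 2 * x'" "b - y = 2 * y'" "c - s = 2 * s'" "d - t = 2 * t'"
      using e by (meson evenE)
    ultimately have "ev u - zeta 12 ^ p * ev v = 2 * ev (x', y', s', t')"
      by (simp add: algebra_simps)
    then show ?thesis by blast
  qed
  let ?m = "\<lambda>x y s t. even (a - x) \<and> even (b - y) \<and> even (c - s) \<and> even (d - t)"
  \<comment> \<open>The six patterns are the coordinates of \<open>zeta 12 ^ p * ev v\<close> for p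
    = 0, 4, 8, 3, 7, 11.\<close>
  have "?m a' b' c' d' \<or> ?m (-c') (-d') (a'-c') (b'-d') \<or> ?m (c'-a') (d'-b') (-a') (-b')
    \<or> ?m (-b') a' (-d') c' \<or> ?m d' (-c') (d'-b') (a'-c') \<or> ?m (b'-d') (c'-a') b' (-a')"
    using assms unfolding u v
    by (cases "even a"; cases "even b"; cases "even c"; cases "even d";
        cases "even a'"; cases "even b'"; cases "even c'"; cases "even d'"; simp)
  then show ?thesis
    using *[of a' b' c' d' 0] *[of "-c'" "-d'" "a'-c'" "b'-d'" 4] *[of "c'-a'" "d'-b'" "-a'" "-b'" 8]
     *[of "-b'" a' "-d'" c' 3] *[of d' "-c'" "d'-b'" "a'-c'" 7] *[of "b'-d'" "c'-a'" b' "-a'" 11]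
    by (auto simp: v zeta12_powers omega_sq omega_sq' algebra_simps)
qed

text \<open>Modulo 1 + i the ring becomes the field with four elements, and w becomes (a + b) + (c +
  d) omega. Its norm there is \<open>norm_int w + norm_sqrt3 w\<close> modulo 2, so evenness forces
  both a + b and c + d to be even.\<close>

lemma even_type: "even (norm_int w) \<Longrightarrow> even (norm_sqrt3 w) \<Longrightarrow> \<exists>v. ev w = (1 + \<i>) * ev v"
proof (cases w)
  case (fields a b c d)
  assume "even (norm_int w)" "even (norm_sqrt3 w)"
  then have "even (a + b)" "even (c + d)" unfolding fields by auto
  then obtain s t where "a + b = 2 * s" "c + d = 2 * t" by (meson evenE)
  then have e: "a = 2 * s - b" "c = 2 * t - d" by auto
  have "ev w = (1 + \<i>) * ev (s, b - s, t, d - t)" unfolding fields e by (simp add: algebra_simps)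
  then show ?thesis by blast
qed

text \<open>A converse to \<open>even_type\<close>, as 1 - i is -i times 1 + i.\<close>

lemma type_of_multiple: "\<exists>w. ev w = (1 - \<i>) * ev v \<and> even (norm_int w) \<and> even (norm_sqrt3 w)"
proof (cases v)
  case (fields a b c d)
  have "ev (a + b, b - a, c + d, d - c) = (1 - \<i>) * ev v" unfolding fields by (simp add: algebra_simps)
  moreover have "even (norm_int (a + b, b - a, c + d, d - c))" "even (norm_sqrt3 (a + b, b - a, c + d, d - c))" 
    by auto
  ultimately show ?thesis by blast
qed

subsection \<open>Decomposition of unitaries over the twelfth cyclotomic ring\<close>

text \<open>The parameter \<open>S\<close> bounds the levels that may be touched. It lets a column
  be reduced without disturbing the basis vectors already reached.\<close>

inductive_set gen :: "nat set \<Rightarrow> (state \<Rightarrow> state) set" for S :: "nat set" where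
  gen_id: "id \<in> gen S"
| gen_D: "G \<in> gen S \<Longrightarrow> j \<in> S \<Longrightarrow> level_phase j (zeta 12 ^ p) \<circ> G \<in> gen S"
| gen_K: "G \<in> gen S \<Longrightarrow> j \<in> S \<Longrightarrow> l \<in> S \<Longrightarrow> j \<noteq> l \<Longrightarrow> level_mix j l \<circ> G \<in> gen S"

lemma gen_comp: "F \<in> gen S \<Longrightarrow> G \<in> gen S \<Longrightarrow> F \<circ> G \<in> gen S"
  by (induction F rule: gen.induct) (auto simp only: id_o comp_assoc intro: gen.intros)

lemma gen_level_phase: "j \<in> S \<Longrightarrow> level_phase j (zeta 12 ^ p) \<in> gen S"
  using gen_D[OF gen_id] by simp

lemma gen_level_mix: "j \<in> S \<Longrightarrow> l \<in> S \<Longrightarrow> j \<noteq> l \<Longrightarrow> level_mix j l \<in> gen S"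
  using gen_K[OF gen_id] by simp

lemma gen_mono: "G \<in> gen S \<Longrightarrow> S \<subseteq> T \<Longrightarrow> G \<in> gen T"
  by (induction G rule: gen.induct) (auto intro: gen.intros)

lemma rep_gen:
  assumes "1 \<le> n" "G \<in> gen {..<2 ^ n}" shows "rep n G"
  using assms(2)
proof induction
  case gen_id show ?case by (rule rep_id)
next
  case (gen_D G j p)
  have "zeta 12 ^ p = zeta 24 ^ (2 * p)"
    by (simp add: zeta_def DeMoivre mult.commute)
  then show ?case using gen_D assms(1) by (simp only:) (intro rep_comp rep_level_phase; simp)
next
  case (gen_K G j l)
  then show ?case by (intro rep_comp rep_level_mix) auto
qed

lemma gen_outside: "G \<in> gen S \<Longrightarrow> x \<notin> S \<Longrightarrow> G \<psi> x = \<psi> x"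
  by (induction G rule: gen.induct) (auto simp: level_phase_def level_mix_def)

lemma gen_fix: "G \<in> gen S \<Longrightarrow> (\<And>x. x \<in> S \<Longrightarrow> \<psi> x = 0) \<Longrightarrow> G \<psi> = \<psi>"
  by (induction G rule: gen.induct) (auto simp: level_phase_def level_mix_def fun_eq_iff)

section \<open>Inner products and their invariance\<close>

definition inner :: "nat set \<Rightarrow> state \<Rightarrow> state \<Rightarrow> complex" where
  "inner T \<phi> \<psi> = (\<Sum>x\<in>T. cnj (\<phi> x) * \<psi> x)"

lemma zeta_cnj: "cnj (zeta n ^ p) * zeta n ^ p = 1"
  by (simp add: zeta_def DeMoivre cis_cnj cis_mult)

lemma zeta_cnj_mult: "cnj (zeta n ^ p) * y * (zeta n ^ p * z) = y * z"
  using zeta_cnj[of n p] by (simp add: ac_simps)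

lemma inner_level_phase:
  assumes "finite T" "j \<in> T"
  shows "inner T (level_phase j (zeta 12 ^ p) \<phi>) (level_phase j (zeta 12 ^ p) \<psi>) = inner T \<phi> \<psi>"
  unfolding inner_def level_phase_def using assms
  by (intro sum.cong) (auto simp: zeta_cnj_mult[of 12, simplified])

lemma inner_level_mix:
  assumes "finite T" "j \<in> T" "l \<in> T" "j \<noteq> l"
  shows "inner T (level_mix j l \<phi>) (level_mix j l \<psi>) = inner T \<phi> \<psi>"
proof -
  have sum2: "sum f T = f j + (f l + sum f (T - {j} - {l}))" for f :: "nat \<Rightarrow> complex"
    using assms by (simp add: sum.remove[of T j] sum.remove[of "T - {j}" l])
  have K: "level_mix j l \<chi> j = (1 - \<i>) * (\<chi> j + \<chi> l) / 2" "level_mix j l \<chi> l = (1 - \<i>) * (\<chi> j - \<chi> l) / 2" for \<chi>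
    using assms by (simp_all add: level_mix_def inv_1i)
  have "(\<Sum>x\<in>T - {j} - {l}. cnj (level_mix j l \<phi> x) * level_mix j l \<psi> x) = (\<Sum>x\<in>T - {j} - {l}. cnj (\<phi> x) * \<psi> x)"
    by (intro sum.cong) (auto simp: level_mix_def)
  moreover have "cnj (level_mix j l \<phi> j) * level_mix j l \<psi> j + cnj (level_mix j l \<phi> l) * level_mix j l \<psi> l
      = cnj (\<phi> j) * \<psi> j + cnj (\<phi> l) * \<psi> l"
    unfolding K by (simp add: field_simps)
  ultimately show ?thesis unfolding inner_def sum2 by (simp add: add.assoc[symmetric])
qed

lemma inner_gen:
  assumes "G \<in> gen S" "S \<subseteq> T" "finite T"
  shows "inner T (G \<phi>) (G \<psi>) = inner T \<phi> \<psi>"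
  using assms(1)
proof induction
  case (gen_D G j p)
  then show ?case using inner_level_phase[of T j p] assms by auto
next
  case (gen_K G j l)
  then have "j \<in> T" "l \<in> T" using assms by auto
  then show ?case using gen_K assms by (simp add: inner_level_mix)
qed simp

definition unitvec :: "nat \<Rightarrow> state" where
  "unitvec c = (\<lambda>x. if x = c then 1 else 0)"

lemma odd_sum_partner:
  fixes f :: "nat \<Rightarrow> int"
  assumes "finite S" "even (sum f S)" "j \<in> S" "odd (f j)"
  shows "\<exists>l\<in>S. l \<noteq> j \<and> odd (f l)"
proof (rule ccontr)
  assume "\<not> ?thesis"
  then have "even (sum f (S - {j}))" by (intro dvd_sum) auto
  then show False using assms by (simp add: sum.remove)
qed

text \<open>The squared norm 1 is multiplied by |1 + i|^(2k) = 2^k, and the coefficients of 1 and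
  sqrt 3 are compared. For positive \<open>k\<close> both sums are therefore even.\<close>

lemma norm_sums:
  assumes "\<And>j. \<psi> j = ev (w j) / (1 + \<i>) ^ k" "inner S \<psi> \<psi> = 1" "finite S"
  shows "(\<Sum>j\<in>S. norm_int (w j)) = 2 ^ k" "(\<Sum>j\<in>S. norm_sqrt3 (w j)) = 0"
proof -
  have ne: "cnj (1 + \<i>) ^ k * (1 + \<i>) ^ k = 2 ^ k"
    by (simp flip: power_mult_distrib) (simp add: algebra_simps)
  have "cnj (\<psi> j) * \<psi> j = complex_of_real (of_int (norm_int (w j)) + of_int (norm_sqrt3 (w j)) * sqrt 3) / 2 ^ k" for j
    unfolding assms(1) ev_norm[symmetric] ne[symmetric] by simp
  then have "complex_of_real (\<Sum>j\<in>S. of_int (norm_int (w j)) + of_int (norm_sqrt3 (w j)) * sqrt 3) / 2 ^ k = 1"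
    using assms(2) unfolding inner_def by (simp add: sum_divide_distrib)
  then have "complex_of_real (\<Sum>j\<in>S. of_int (norm_int (w j)) + of_int (norm_sqrt3 (w j)) * sqrt 3) = complex_of_real (2 ^ k)"
    by simp
  then have "(\<Sum>j\<in>S. of_int (norm_int (w j)) + of_int (norm_sqrt3 (w j)) * sqrt 3) = 2 ^ k"
    by (simp only: of_real_eq_iff)
  then have "of_int ((\<Sum>j\<in>S. norm_int (w j)) - 2 ^ k) + of_int (\<Sum>j\<in>S. norm_sqrt3 (w j)) * sqrt 3 = 0"
    by (simp add: sum.distrib sum_distrib_right)
  then have "(\<Sum>j\<in>S. norm_int (w j)) - 2 ^ k = 0 \<and> (\<Sum>j\<in>S. norm_sqrt3 (w j)) = 0"
    by (rule sqrt3_indep)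
  then show "(\<Sum>j\<in>S. norm_int (w j)) = 2 ^ k" "(\<Sum>j\<in>S. norm_sqrt3 (w j)) = 0"
    by simp_all
qed

lemma gen_move:
  assumes "j \<in> S" "c \<in> S"
  shows "\<exists>G\<in>gen S. G (unitvec j) = unitvec c"
proof (cases "j = c")
  case True then show ?thesis by (intro bexI[OF _ gen_id]) simp
next
  case False
  \<comment> \<open>The phase \<open>zeta 12 ^ 6\<close> is Z on the levels \<open>j\<close> and
    \<open>c\<close>; between the two mixes it becomes -i X, as (1 + i)^2 = 2 i. The phase
    \<open>zeta 12 ^ 3 = \<i>\<close> removes the factor at \<open>c\<close>.\<close>
  let ?G = "level_phase c (zeta 12 ^ 3) \<circ> (level_mix j c \<circ> (level_phase c (zeta 12 ^ 6) \<circ> level_mix j c))"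
  have "?G \<in> gen S" using assms False by (intro gen_comp gen_level_phase gen_level_mix)
  moreover have "?G (unitvec j) = unitvec c"
    using False by (auto simp: fun_eq_iff level_phase_def level_mix_def unitvec_def zeta12_powers inv_1i field_simps)
  ultimately show ?thesis by blast
qed

text \<open>Nonnegative integers \<open>norm_int (w j)\<close> with sum 1 leave one entry of norm 1,
  a root of unity, and zeros elsewhere. A phase and a move finish.\<close>

lemma reduce_integral:
  assumes "finite S" "c \<in> S" "\<And>j. \<psi> j = ev (w j)" "\<And>j. j \<notin> S \<Longrightarrow> \<psi> j = 0" "inner S \<psi> \<psi> = 1"
  shows "\<exists>G\<in>gen S. G \<psi> = unitvec c"
proof -
  have s: "(\<Sum>j\<in>S. norm_int (w j)) = 1" using norm_sums[of \<psi> w 0 S] assms by simp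
  then obtain j where j: "j \<in> S" "norm_int (w j) \<noteq> 0" by (metis sum.neutral zero_neq_one)
  have "norm_int (w j) + (\<Sum>x\<in>S - {j}. norm_int (w x)) = 1"
    using s j(1) assms(1) by (simp add: sum.remove)
  moreover have "0 \<le> (\<Sum>x\<in>S - {j}. norm_int (w x))" by (intro sum_nonneg norm_int_nonneg)
  ultimately have n: "norm_int (w j) = 1" "(\<Sum>x\<in>S - {j}. norm_int (w x)) = 0"
    using j(2) norm_int_nonneg[of "w j"] by linarith+
  then have "\<forall>x\<in>S - {j}. norm_int (w x) = 0"
    using assms(1) by (subst (asm) sum_nonneg_eq_0_iff) (auto simp: norm_int_nonneg)
  then have z: "\<psi> x = 0" if "x \<noteq> j" for x
  proof (cases "x \<in> S")
    case True
    then have "w x = (0, 0, 0, 0)" using \<open>\<forall>x\<in>S - {j}. _\<close> that norm_int_eq_0 by blast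
    then show ?thesis unfolding assms(3) by (simp only: ev_0)
  qed (rule assms(4))
  obtain p where "zeta 12 ^ p * ev (w j) = 1" using norm_int_eq_1[OF n(1)] by blast
  then have "level_phase j (zeta 12 ^ p) \<psi> = unitvec j"
    using z by (simp add: level_phase_def unitvec_def fun_eq_iff flip: assms(3))
  moreover obtain G where "G \<in> gen S" "G (unitvec j) = unitvec c" using gen_move j(1) assms(2) by blast
  ultimately show ?thesis
    using gen_comp gen_level_phase[OF j(1)] by (metis comp_apply)
qed

text \<open>Outer induction on the exponent \<open>k\<close>, inner induction on the number of
  entries in \<open>S\<close> whose numerator is prime to 1 + i. Such an entry has a partner of the
  same type by parity of the two sums; when none is left, every numerator is divided by 1 +
  i.\<close>

lemma reduce_column:
  assumes "finite S" "c \<in> S" "\<And>j. \<psi> j = ev (w j) / (1 + \<i>) ^ k" "\<And>j. j \<notin> S \<Longrightarrow> \<psi> j = 0" "inner S \<psi> \<psi> = 1"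
  shows "\<exists>G\<in>gen S. G \<psi> = unitvec c"
  using assms(3-5)
proof (induction k arbitrary: \<psi> w)
  case 0
  then show ?case using reduce_integral[OF assms(1,2)] by simp
next
  case (Suc k)
  have ne: "1 + \<i> \<noteq> 0" by (simp add: complex_eq_iff)
  show ?case using Suc.prems
  proof (induction "card {j\<in>S. odd (norm_int (w j)) \<or> odd (norm_sqrt3 (w j))}" arbitrary: \<psi> w rule: less_induct)
    case less
    show ?case
    proof (cases "\<forall>j\<in>S. even (norm_int (w j)) \<and> even (norm_sqrt3 (w j))")
      case True
      have "\<exists>v. \<psi> j = ev v / (1 + \<i>) ^ k" for j
      proof (cases "j \<in> S")
        case True
        with \<open>\<forall>j\<in>S. _\<close> obtain v where "ev (w j) = (1 + \<i>) * ev v" using even_type by blast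
        then have "\<psi> j = ev v / (1 + \<i>) ^ k" using ne less.prems(1)[of j] by simp
        then show ?thesis by blast
      next
        case False
        then show ?thesis using less.prems(2) by (intro exI[of _ "(0,0,0,0)"]) simp
      qed
      then obtain v where "\<And>j. \<psi> j = ev (v j) / (1 + \<i>) ^ k" by metis
      then show ?thesis using Suc.IH less.prems(2,3) by blast
    next
      case False
      then obtain j where j: "j \<in> S" "odd (norm_int (w j)) \<or> odd (norm_sqrt3 (w j))" by blast
      have ev: "even (\<Sum>j\<in>S. norm_int (w j))" "even (\<Sum>j\<in>S. norm_sqrt3 (w j))"
        using norm_sums[OF less.prems(1,3) assms(1)] by simp_all
      obtain l where l: "l \<in> S" "l \<noteq> j"
        "odd (norm_int (w j)) \<and> odd (norm_int (w l)) \<or> odd (norm_sqrt3 (w j)) \<and> odd (norm_sqrt3 (w l))"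
        using odd_sum_partner[OF assms(1) ev(1) j(1)] odd_sum_partner[OF assms(1) ev(2) j(1)] j(2) by blast
      obtain p z where pz: "ev (w j) - zeta 12 ^ p * ev (w l) = 2 * ev z"
        using same_type_congruent[OF l(3)] by blast
      have "\<exists>y. ev y = zeta 12 ^ p * ev (w l)"
      proof -
        have "ev (0, 0, 0, -1) = zeta 12" by (simp add: zeta12_eq)
        then obtain t where "ev t = zeta 12 ^ p" using ev_power[of "(0, 0, 0, -1)" p] by auto
        then show ?thesis using ev_mult[of t "w l"] by simp
      qed
      \<comment> \<open>After the phase, entry \<open>l\<close> has numerator w' congruent to
        \<open>ev (w j)\<close> modulo 2. As 2/(1 + i) = 1 - i, the mixed numerators are (1 - i)(z +
        w') and (1 - i) z, so neither entry is counted any more.\<close>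
      then obtain y where y: "ev y = ev z + zeta 12 ^ p * ev (w l)" using ev_add by metis
      obtain u where u: "ev u = (1 - \<i>) * ev y" "even (norm_int u)" "even (norm_sqrt3 u)" using type_of_multiple by blast
      obtain v where v: "ev v = (1 - \<i>) * ev z" "even (norm_int v)" "even (norm_sqrt3 v)" using type_of_multiple by blast
      let ?F = "level_mix j l \<circ> level_phase l (zeta 12 ^ p)"
      let ?w = "w(j := u, l := v)"
      have F: "?F \<in> gen S" using j l by (intro gen_comp gen_level_phase gen_level_mix) auto
      have "?F \<psi> x = ev (?w x) / (1 + \<i>) ^ Suc k" for x
      proof -
        have "ev (w j) = 2 * ev z + zeta 12 ^ p * ev (w l)" using pz by (simp add: algebra_simps)
        then have a: "(ev (w j) + zeta 12 ^ p * ev (w l)) / (1 + \<i>) = ev u"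
          "(ev (w j) - zeta 12 ^ p * ev (w l)) / (1 + \<i>) = ev v"
          unfolding inv_1i u v y by simp_all
        have "?F \<psi> j = ((ev (w j) + zeta 12 ^ p * ev (w l)) / (1 + \<i>)) / (1 + \<i>) ^ Suc k"
          "?F \<psi> l = ((ev (w j) - zeta 12 ^ p * ev (w l)) / (1 + \<i>)) / (1 + \<i>) ^ Suc k"
          using l(2) by (simp_all add: level_mix_def level_phase_def less.prems(1) add_divide_distrib diff_divide_distrib mult.commute)
        moreover have "?F \<psi> x = \<psi> x" if "x \<noteq> j" "x \<noteq> l" using that by (simp add: level_mix_def level_phase_def)
        ultimately show ?thesis unfolding a using less.prems(1) l(2) by auto
      qed
      moreover have "?F \<psi> x = 0" if "x \<notin> S" for x
        using gen_outside[OF F that] less.prems(2)[OF that] by simp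
      moreover have "inner S (?F \<psi>) (?F \<psi>) = 1"
        using inner_gen[OF F order_refl assms(1)] less.prems(3) by simp
      moreover have "card {x\<in>S. odd (norm_int (?w x)) \<or> odd (norm_sqrt3 (?w x))} < card {x\<in>S. odd (norm_int (w x)) \<or> odd (norm_sqrt3 (w x))}"
        using u v j assms(1) by (intro psubset_card_mono) auto
      ultimately obtain G where "G \<in> gen S" "G (?F \<psi>) = unitvec c" using less.hyps by blast
      then show ?thesis using gen_comp[OF _ F] by (metis comp_apply)
    qed
  qed
qed

section \<open>The ring obtained by inverting 2\<close>

definition R12 :: "complex set" where
  "R12 = {ev w / 2 ^ k | w k. True}"

lemma R12_I: "ev w / 2 ^ k \<in> R12" unfolding R12_def by blast

lemma R12_ev: "ev w \<in> R12" using R12_I[of w 0] by simp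

lemma R12_mult: assumes "x \<in> R12" "y \<in> R12" shows "x * y \<in> R12"
proof -
  obtain u k v l where "x = ev u / 2 ^ k" "y = ev v / 2 ^ l" using assms unfolding R12_def by blast
  moreover obtain w where "ev w = ev u * ev v" using ev_mult by blast
  ultimately have "x * y = ev w / 2 ^ (k + l)" by (simp add: power_add)
  then show ?thesis using R12_I by simp
qed

lemma R12_add: assumes "x \<in> R12" "y \<in> R12" shows "x + y \<in> R12"
proof -
  obtain u k v l where xy: "x = ev u / 2 ^ k" "y = ev v / 2 ^ l" using assms unfolding R12_def by blast
  obtain u' v' where uv: "ev u' = ev (2 ^ l, 0, 0, 0) * ev u" "ev v' = ev (2 ^ k, 0, 0, 0) * ev v" using ev_mult by metis
  obtain w where w: "ev w = ev u' + ev v'" using ev_add by blast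
  have "x + y = ev w / 2 ^ (k + l)" unfolding xy w uv by (simp add: power_add field_simps)
  then show ?thesis using R12_I by simp
qed

lemma R12_uminus: "x \<in> R12 \<Longrightarrow> - x \<in> R12"
  using R12_mult[OF R12_ev[of "(-1,0,0,0)"]] by simp

lemma R12_cnj: "x \<in> R12 \<Longrightarrow> cnj x \<in> R12"
  unfolding R12_def using ev_cnj by auto (metis complex_cnj_divide complex_cnj_power complex_cnj_numeral)

lemma R12_sum: "(\<And>i. i \<in> A \<Longrightarrow> f i \<in> R12) \<Longrightarrow> sum f A \<in> R12"
  by (induction A rule: infinite_finite_induct) (auto intro: R12_add R12_ev[of "(0,0,0,0)", simplified])

lemma R12_zeta12: "zeta 12 ^ p \<in> R12"
proof (induction p)
  case 0 show ?case using R12_ev[of "(1,0,0,0)"] by simp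
next
  case (Suc p)
  have "zeta 12 \<in> R12" unfolding zeta12_eq using R12_ev[of "(0,0,0,-1)"] by simp
  then show ?case using Suc R12_mult by simp
qed

lemma R12_gen: "G \<in> gen S \<Longrightarrow> (\<And>x. \<psi> x \<in> R12) \<Longrightarrow> G \<psi> x \<in> R12"
proof (induction G arbitrary: x rule: gen.induct)
  case (gen_D G j p)
  then show ?case by (auto simp: level_phase_def intro: R12_mult R12_zeta12)
next
  case (gen_K G j l)
  have h: "y / (1 + \<i>) \<in> R12" if "y \<in> R12" for y
  proof -
    have "y / (1 + \<i>) = ev (1,-1,0,0) / 2 ^ 1 * y" unfolding inv_1i by simp
    then show ?thesis using that R12_mult R12_I by metis
  qed
  have "G \<psi> j - G \<psi> l \<in> R12" "G \<psi> j + G \<psi> l \<in> R12"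
    using gen_K R12_add[OF _ R12_uminus] R12_add by (metis diff_conv_add_uminus)+
  then show ?case using gen_K by (auto simp: level_mix_def intro: h)
qed simp

lemma reduce_column_R12:
  assumes "finite S" "c \<in> S" "\<And>j. \<psi> j \<in> R12" "\<And>j. j \<notin> S \<Longrightarrow> \<psi> j = 0" "inner S \<psi> \<psi> = 1"
  shows "\<exists>G\<in>gen S. G \<psi> = unitvec c"
proof -
  have "\<exists>K. \<forall>j\<in>T. \<exists>w. \<psi> j = ev w / 2 ^ K" if "finite T" for T
    using that
  proof induction
    case (insert j T)
    then obtain K where K: "\<forall>j\<in>T. \<exists>w. \<psi> j = ev w / 2 ^ K" by blast
    obtain u k where u: "\<psi> j = ev u / 2 ^ k" using assms(3)[of j] unfolding R12_def by blast
    have scale: "\<exists>w. ev v / 2 ^ l = ev w / 2 ^ (l + l')" for v l l'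
    proof -
      obtain w where "ev w = ev (2 ^ l', 0, 0, 0) * ev v" using ev_mult by blast
      then have "ev v / 2 ^ l = ev w / 2 ^ (l + l')" by (simp add: power_add)
      then show ?thesis by blast
    qed
    show ?case
      using K u scale[of _ K k] scale[of _ k K] by (intro exI[of _ "K + k"]) (metis add.commute insertE)
  qed simp
  from this[OF assms(1)] obtain K where K: "\<forall>j\<in>S. \<exists>w. \<psi> j = ev w / 2 ^ K" by blast
  have "\<exists>w. \<psi> j = ev w / (1 + \<i>) ^ (2 * K)" for j
  proof (cases "j \<in> S")
    case True
    then obtain w where w: "\<psi> j = ev w / 2 ^ K" using K by blast
    \<comment> \<open>From (1 + i)^2 = 2 i, passing from denominator 2^K to (1 + i)^(2K) costs a
      factor i^K in the numerator.\<close>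
    obtain v where v: "ev v = ev (0,1,0,0) ^ K * ev w" using ev_mult ev_power by metis
    have "(1 + \<i>) ^ (2 * K) = (\<i> * 2) ^ K"
      unfolding power_mult by (simp add: power2_eq_square algebra_simps)
    then have "\<psi> j = ev v / (1 + \<i>) ^ (2 * K)" unfolding w v by (simp add: power_mult_distrib)
    then show ?thesis by blast
  next
    case False
    then show ?thesis using assms(4) by (intro exI[of _ "(0,0,0,0)"]) simp
  qed
  then obtain w where "\<And>j. \<psi> j = ev (w j) / (1 + \<i>) ^ (2 * K)" by metis
  then show ?thesis using reduce_column[OF assms(1,2)] assms(4,5) by blast
qed

lemma inner_unitvec: "finite T \<Longrightarrow> i \<in> T \<Longrightarrow> inner T (unitvec i) \<psi> = \<psi> i"
proof -
  assume T: "finite T" "i \<in> T"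
  have "inner T (unitvec i) \<psi> = (\<Sum>x\<in>T. if x = i then \<psi> x else 0)"
    unfolding inner_def unitvec_def by (intro sum.cong) auto
  then show ?thesis using T by simp
qed

text \<open>Columns are treated in turn. Orthogonality to the basis vectors already reached makes
  the next column vanish below \<open>c\<close>, so it can be reduced within \<open>{c..<N}\<close>,
  and operators on these levels fix the earlier basis vectors.\<close>

lemma decompose:
  assumes "\<And>i x. i < N \<Longrightarrow> u i x \<in> R12" "\<And>i x. i < N \<Longrightarrow> N \<le> x \<Longrightarrow> u i x = 0"
    "\<And>i j. i < N \<Longrightarrow> j < N \<Longrightarrow> inner {..<N} (u i) (u j) = (if i = j then 1 else 0)"
  shows "\<exists>G\<in>gen {..<N}. \<forall>i<N. G (u i) = unitvec i"
proof -
  have "c \<le> N \<Longrightarrow> \<exists>G\<in>gen {..<N}. \<forall>i<c. G (u i) = unitvec i" for c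
  proof (induction c)
    case 0 then show ?case using gen_id by blast
  next
    case (Suc c)
    then obtain G where G: "G \<in> gen {..<N}" "\<forall>i<c. G (u i) = unitvec i" by auto
    let ?\<psi> = "G (u c)"
    have low: "?\<psi> x = 0" if "x \<notin> {c..<N}" for x
    proof (cases "x < c")
      case True
      have "inner {..<N} (G (u x)) (G (u c)) = 0"
        using inner_gen[OF G(1) order_refl] assms(3)[of x c] True Suc.prems by simp
      then show ?thesis using G(2) True Suc.prems by (simp add: inner_unitvec)
    next
      case False
      then show ?thesis using that gen_outside[OF G(1)] assms(2)[of c x] Suc.prems by simp
    qed
    have "inner {..<N} ?\<psi> ?\<psi> = 1"
      using inner_gen[OF G(1) order_refl] assms(3)[of c c] Suc.prems by simp
    moreover have "inner {..<N} ?\<psi> ?\<psi> = inner {c..<N} ?\<psi> ?\<psi>"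
      unfolding inner_def by (intro sum.mono_neutral_right) (use low in auto)
    ultimately have "\<exists>F\<in>gen {c..<N}. F ?\<psi> = unitvec c"
      using low R12_gen[OF G(1)] assms(1) Suc.prems by (intro reduce_column_R12) auto
    then obtain F where F: "F \<in> gen {c..<N}" "F ?\<psi> = unitvec c" by blast
    have "F (unitvec i) = unitvec i" if "i < c" for i
      using that by (intro gen_fix[OF F(1)]) (auto simp: unitvec_def)
    then have "\<forall>i<Suc c. (F \<circ> G) (u i) = unitvec i" using G(2) F(2) by (auto simp: less_Suc_eq)
    moreover have "F \<circ> G \<in> gen {..<N}"
      using F(1) G(1) by (intro gen_comp) (auto elim: gen_mono)
    ultimately show ?case by blast
  qed
  then show ?thesis by blast
qed

text \<open>Reducing the conjugated rows of \<open>W\<close>, instead of its columns, to the standard basis yields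
  \<open>W\<close> itself rather than its inverse.\<close>

lemma synthesize:
  assumes "\<And>i x. i < N \<Longrightarrow> x < N \<Longrightarrow> W i x \<in> R12"
    "\<And>i j. i < N \<Longrightarrow> j < N \<Longrightarrow> (\<Sum>x<N. W i x * cnj (W j x)) = (if i = j then 1 else 0)"
  shows "\<exists>G\<in>gen {..<N}. \<forall>\<psi>. \<forall>i<N. G \<psi> i = (\<Sum>x<N. W i x * \<psi> x)"
proof -
  define u where "u i = (\<lambda>x. if x < N then cnj (W i x) else 0)" for i
  have "\<exists>G\<in>gen {..<N}. \<forall>i<N. G (u i) = unitvec i"
  proof (rule decompose)
    show "u i x \<in> R12" if "i < N" for i x
      using that assms(1) R12_ev[of "(0,0,0,0)"] by (auto simp: u_def intro: R12_cnj)
    show "inner {..<N} (u i) (u j) = (if i = j then 1 else 0)" if "i < N" "j < N" for i j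
      using that assms(2)[of i j] by (simp add: inner_def u_def)
  qed (simp add: u_def)
  then obtain G where G: "G \<in> gen {..<N}" "\<forall>i<N. G (u i) = unitvec i" by blast
  have "G \<psi> i = (\<Sum>x<N. W i x * \<psi> x)" if "i < N" for \<psi> i
  proof -
    have "G \<psi> i = inner {..<N} (G (u i)) (G \<psi>)" using G(2) that by (simp add: inner_unitvec)
    also have "\<dots> = inner {..<N} (u i) \<psi>" using inner_gen[OF G(1) order_refl] by simp
    also have "\<dots> = (\<Sum>x<N. W i x * \<psi> x)" by (simp add: inner_def u_def)
    finally show ?thesis .
  qed
  then show ?thesis using G(1) by blast
qed

subsection \<open>Catalytic embedding\<close>

lemma zeta_24_24: "zeta 24 ^ 24 = 1"
  by (simp add: zeta_24_power)

lemma zeta_24_split: "zeta 24 = z8 * zeta 12 ^ 11"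
proof -
  have "zeta 12 = zeta 24 ^ 2" by (simp add: zeta_24_power) (simp add: zeta_def)
  then have "z8 * zeta 12 ^ 11 = zeta 24 ^ 3 * zeta 24 ^ 22" by (simp add: z8_eq flip: power_mult)
  also have "\<dots> = zeta 24 ^ 24 * zeta 24" by (simp flip: power_add power_Suc2)
  finally show ?thesis by (simp add: zeta_24_24)
qed

lemma R12_numerals: "0 \<in> R12" "1 \<in> R12" "1 / 2 \<in> R12" "\<i> \<in> R12"
  using R12_ev[of "(0,0,0,0)"] R12_ev[of "(1,0,0,0)"] R12_I[of "(1,0,0,0)" 1] R12_ev[of "(0,1,0,0)"] by simp_all

text \<open>Closure under products rests on \<open>z8 * z8 = \<i>\<close> lying in
  \<open>R12\<close>; the generator \<open>zeta 24\<close> is covered by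
  \<open>zeta_24_split\<close>.\<close>

lemma Rring_split: "z \<in> Rring 24 \<Longrightarrow> \<exists>x\<in>R12. \<exists>y\<in>R12. z = x + z8 * y"
proof (induction rule: Rring.induct)
  case one
  show ?case using R12_numerals by (intro bexI[of _ 1] bexI[of _ 0]) auto
next
  case half
  show ?case using R12_numerals by (intro bexI[of _ "1/2"] bexI[of _ 0]) auto
next
  case zet
  show ?case using R12_numerals R12_zeta12 zeta_24_split
    by (intro bexI[of _ 0] bexI[of _ "zeta 12 ^ 11"]) auto
next
  case (add x y)
  then obtain a b c d where "a \<in> R12" "b \<in> R12" "c \<in> R12" "d \<in> R12" "x = a + z8 * b" "y = c + z8 * d" by blast
  then show ?case by (intro bexI[of _ "a + c"] bexI[of _ "b + d"]) (auto simp: algebra_simps intro: R12_add)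
next
  case (neg x)
  then obtain a b where "a \<in> R12" "b \<in> R12" "x = a + z8 * b" by blast
  then show ?case by (intro bexI[of _ "- a"] bexI[of _ "- b"]) (auto intro: R12_uminus)
next
  case (mul x y)
  then obtain a b c d where *: "a \<in> R12" "b \<in> R12" "c \<in> R12" "d \<in> R12" "x = a + z8 * b" "y = c + z8 * d" by blast
  have "x * y = a * c + (z8 * z8) * (b * d) + z8 * (a * d + b * c)"
    unfolding * by (simp add: algebra_simps)
  then show ?case unfolding z8_sq
    using * R12_numerals by (intro bexI[of _ "a * c + \<i> * (b * d)"] bexI[of _ "a * d + b * c"]) (auto intro: R12_add R12_mult)
qed

lemma R12_z8_indep:
  assumes "x \<in> R12" "y \<in> R12" "x + z8 * y = 0" shows "x = 0 \<and> y = 0"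
proof -
  obtain u k v l where xy: "x = ev u / 2 ^ k" "y = ev v / 2 ^ l" using assms unfolding R12_def by blast
  obtain u' where u': "ev u' = ev (2 ^ l, 0, 0, 0) * ev u" using ev_mult by metis
  obtain v' where v': "ev v' = ev (2 ^ k, 0, 0, 0) * ev v" using ev_mult by metis
  have "ev u' + z8 * ev v' = 2 ^ (k + l) * (x + z8 * y)"
    unfolding xy u' v' by (simp add: power_add field_simps)
  then have "ev u' = 0 \<and> ev v' = 0" using assms(3) by (intro ev_z8_indep) simp
  then show ?thesis unfolding u' v' xy by simp
qed

lemma sum_lessThan_double: "(\<Sum>x<2 * M. f x) = (\<Sum>j<M. f (2 * j) + f (Suc (2 * j)))" for f :: "nat \<Rightarrow> complex"
  by (induction M) (simp_all add: add.assoc)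

lemma cnj_z8: "cnj z8 = - \<i> * z8"
  by (simp add: z8_def field_simps)

text \<open>\<open>A + z8 B\<close> becomes \<open>A \<otimes> I + B \<otimes> \<Lambda>\<close>, where \<open>\<Lambda> = [[0, \<i>], [1, 0]]\<close> acts on bit 0 and
  \<open>\<Lambda>\<^sup>2 = \<i> = z8\<^sup>2\<close>.\<close>

definition catalytic :: "(nat \<Rightarrow> nat \<Rightarrow> complex) \<Rightarrow> (nat \<Rightarrow> nat \<Rightarrow> complex) \<Rightarrow> nat \<Rightarrow> nat \<Rightarrow> complex" where
  "catalytic A B r x = (if even r \<longleftrightarrow> even x then A (r div 2) (x div 2)
     else if even r then \<i> * B (r div 2) (x div 2) else B (r div 2) (x div 2))"

text \<open>As \<open>cnj z8 = - \<i> * z8\<close>, row orthonormality of A + z8 B reads (P - delta)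
  + z8 (Q - i Q') = 0 with both brackets in \<open>R12\<close>. Independence gives P = delta and Q =
  i Q', and these settle the four parity cases of the enlarged rows.\<close>

lemma catalytic_orthonormal:
  assumes R: "\<And>i j. i < M \<Longrightarrow> j < M \<Longrightarrow> A i j \<in> R12 \<and> B i j \<in> R12"
    and orth: "\<And>i i'. i < M \<Longrightarrow> i' < M \<Longrightarrow>
      (\<Sum>j<M. (A i j + z8 * B i j) * cnj (A i' j + z8 * B i' j)) = (if i = i' then 1 else 0)"
    and "r < 2 * M" "s < 2 * M"
  shows "(\<Sum>x<2 * M. catalytic A B r x * cnj (catalytic A B s x)) = (if r = s then 1 else 0)"
proof -
  define i i' where "i = r div 2" and "i' = s div 2"
  have lt: "i < M" "i' < M" using assms by (auto simp: i_def i'_def)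
  define P where "P = (\<Sum>j<M. A i j * cnj (A i' j) + B i j * cnj (B i' j))"
  define Q where "Q = (\<Sum>j<M. B i j * cnj (A i' j))"
  define Q' where "Q' = (\<Sum>j<M. A i j * cnj (B i' j))"
  define \<delta> :: complex where "\<delta> = (if i = i' then 1 else 0)"
  have z: "z8 * cnj z8 = 1" by (simp add: z8_cis cis_cnj cis_mult)
  have e: "(a + z8 * b) * cnj (c + z8 * d) = (a * cnj c + b * cnj d) + z8 * (b * cnj c) + cnj z8 * (a * cnj d)" for a b c d
  proof -
    have "(a + z8 * b) * cnj (c + z8 * d)
      = (a * cnj c + (z8 * cnj z8) * (b * cnj d)) + z8 * (b * cnj c) + cnj z8 * (a * cnj d)"
      by (simp add: algebra_simps)
    then show ?thesis unfolding z by simp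
  qed
  have "(\<Sum>j<M. (A i j + z8 * B i j) * cnj (A i' j + z8 * B i' j)) = P + z8 * Q + cnj z8 * Q'"
    unfolding e P_def Q_def Q'_def by (simp add: sum.distrib sum_distrib_left)
  then have "(P - \<delta>) + z8 * (Q - \<i> * Q') = 0"
    using orth[OF lt] unfolding \<delta>_def[symmetric] cnj_z8 by (simp add: algebra_simps)
  moreover have "P \<in> R12" "Q \<in> R12" "Q' \<in> R12"
    unfolding P_def Q_def Q'_def using R lt by (auto intro!: R12_sum R12_add R12_mult R12_cnj)
  moreover from this have "P - \<delta> \<in> R12" "Q - \<i> * Q' \<in> R12"
    using R12_add[OF _ R12_uminus] R12_mult R12_numerals unfolding \<delta>_def diff_conv_add_uminus by auto
  ultimately have PQ: "P = \<delta>" "Q = \<i> * Q'" using R12_z8_indep[of "P - \<delta>" "Q - \<i> * Q'"] by auto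
  have ii: "\<i> * b * cnj (\<i> * d) = b * cnj d" for b d by (simp add: algebra_simps)
  have parity: "r = s \<longleftrightarrow> i = i' \<and> (even r \<longleftrightarrow> even s)"
    unfolding i_def i'_def by (auto elim!: evenE oddE)
  have sum: "(\<Sum>x<2 * M. catalytic A B r x * cnj (catalytic A B s x)) =
    (if even r then if even s then P else \<i> * Q + Q' else if even s then Q - \<i> * Q' else P)"
    unfolding sum_lessThan_double catalytic_def i_def[symmetric] i'_def[symmetric] P_def Q_def Q'_def
    by (auto simp: ii sum.distrib sum_distrib_left sum_subtractf sum_negf algebra_simps intro!: sum.cong)
  show ?thesis unfolding sum parity by (auto simp: PQ \<delta>_def)
qed

text \<open>The second factor \<open>(1, z8\<^sup>-\<^sup>1) / sqrt 2\<close> is an eigenvector of \<open>\<Lambda>\<close> for the eigenvalue \<open>z8\<close>.\<close>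

definition catalyst_state :: "state \<Rightarrow> state" where
  "catalyst_state u = (\<lambda>r. (if even r then 1 else z8 ^ 7) * u (r div 2) / complex_of_real (sqrt 2))"

lemma catalytic_catalyst_state:
  assumes "r < 2 * M"
  shows "(\<Sum>x<2 * M. catalytic A B r x * catalyst_state u x)
    = catalyst_state (\<lambda>i. \<Sum>j<M. (A i j + z8 * B i j) * u j) r"
proof -
  have i7: "\<i> * (z8 ^ 7 * y) = z8 * y" for y
  proof -
    have "\<i> * (z8 ^ 7 * y) = z8 * (z8 * z8 ^ 7) * y" by (simp add: z8_powers flip: z8_sq)
    then show ?thesis by (simp add: z8_powers)
  qed
  have i7': "z8 ^ 7 * (z8 * y) = y" for y using z8_powers(4) by (simp flip: mult.assoc)
  show ?thesis
  proof (cases "even r")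
    case True
    have "catalytic A B r (2 * j) * catalyst_state u (2 * j) + catalytic A B r (Suc (2 * j)) * catalyst_state u (Suc (2 * j))
      = (A (r div 2) j + z8 * B (r div 2) j) * u j / complex_of_real (sqrt 2)" for j
    proof -
      have "catalytic A B r (2 * j) * catalyst_state u (2 * j) + catalytic A B r (Suc (2 * j)) * catalyst_state u (Suc (2 * j))
       = (A (r div 2) j * u j + \<i> * (z8 ^ 7 * (B (r div 2) j * u j))) / complex_of_real (sqrt 2)"
        using True by (simp add: catalytic_def catalyst_state_def add_divide_distrib)
      then show ?thesis by (simp add: i7 algebra_simps)
    qed
    then show ?thesis using True
      unfolding sum_lessThan_double by (simp add: catalyst_state_def sum_divide_distrib)
  next
    case False
    have "catalytic A B r (2 * j) * catalyst_state u (2 * j) + catalytic A B r (Suc (2 * j)) * catalyst_state u (Suc (2 * j))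
      = z8 ^ 7 * ((A (r div 2) j + z8 * B (r div 2) j) * u j) / complex_of_real (sqrt 2)" for j
    proof -
      have "catalytic A B r (2 * j) * catalyst_state u (2 * j) + catalytic A B r (Suc (2 * j)) * catalyst_state u (Suc (2 * j))
       = (B (r div 2) j * u j + z8 ^ 7 * (A (r div 2) j * u j)) / complex_of_real (sqrt 2)"
        using False by (simp add: catalytic_def catalyst_state_def add_divide_distrib)
      moreover have "z8 ^ 7 * ((A (r div 2) j + z8 * B (r div 2) j) * u j)
         = z8 ^ 7 * (A (r div 2) j * u j) + z8 ^ 7 * (z8 * (B (r div 2) j * u j))"
        by (simp add: algebra_simps)
      ultimately show ?thesis by (simp add: i7' add.commute)
    qed
    then show ?thesis using False
      unfolding sum_lessThan_double by (simp add: catalyst_state_def sum_divide_distrib sum_distrib_left)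
  qed
qed

section \<open>Preparing and undoing the catalyst\<close>

lemma hadamard_op_lift: "hadamard_op (Suc q) (lift \<psi>) = lift (hadamard_op q \<psi>)"
  by (auto simp: hadamard_op_def lift_def fun_eq_iff bit_Suc even_flip_bit_iff flip_Suc_div)

lemma phase_op_lift: "phase_op (Suc q) z (lift \<psi>) = lift (phase_op q z \<psi>)"
  by (auto simp: phase_op_def diag_op_def lift_def fun_eq_iff bit_Suc)

lemma flip_0_div: "flip_bit 0 x div 2 = x div 2" for x :: nat
  by (simp add: flip_bit_0)

lemma prepare: "phase_op 0 (z8 ^ 7) (hadamard_op 0 (lift u)) = catalyst_state u"
  by (auto simp: phase_op_def diag_op_def hadamard_op_def lift_def catalyst_state_def fun_eq_iff bit_0 even_flip_bit_iff flip_0_div)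

lemma unprepare: "hadamard_op 0 (phase_op 0 z8 (catalyst_state u)) = lift u"
proof -
  have "phase_op 0 z8 (phase_op 0 (z8 ^ 7) \<psi>) = \<psi>" for \<psi>
    by (auto simp: phase_op_def diag_op_def fun_eq_iff z8_powers simp flip: mult.assoc)
  moreover have "hadamard_op 0 (hadamard_op 0 \<psi>) = \<psi>" for \<psi>
    by (auto simp: hadamard_op_def fun_eq_iff field_simps)
  ultimately show ?thesis unfolding prepare[symmetric] by simp
qed

lemma synthesize_R24:
  assumes R: "\<And>i j. i < 2 ^ m \<Longrightarrow> j < 2 ^ m \<Longrightarrow> V i j \<in> Rring 24"
    and orth: "\<And>i i'. i < 2 ^ m \<Longrightarrow> i' < 2 ^ m \<Longrightarrow> (\<Sum>j<2 ^ m. V i j * cnj (V i' j)) = (if i = i' then 1 else 0)"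
  shows "\<exists>F\<in>impl (m + 2). \<forall>u. supported (2 ^ m) u \<longrightarrow>
    F (lift (lift u)) = lift (lift (\<lambda>i. if i < 2 ^ m then \<Sum>j<2 ^ m. V i j * u j else 0))"
proof -
  let ?M = "2 ^ m :: nat"
  have "\<forall>i j. \<exists>x y. i < ?M \<longrightarrow> j < ?M \<longrightarrow> x \<in> R12 \<and> y \<in> R12 \<and> V i j = x + z8 * y"
    using R Rring_split by meson
  then obtain A B where AB: "\<And>i j. i < ?M \<Longrightarrow> j < ?M \<Longrightarrow> A i j \<in> R12 \<and> B i j \<in> R12"
    "\<And>i j. i < ?M \<Longrightarrow> j < ?M \<Longrightarrow> V i j = A i j + z8 * B i j"
    by metis
  have "\<exists>G\<in>gen {..<2 * ?M}. \<forall>\<psi>. \<forall>i<2 * ?M. G \<psi> i = (\<Sum>x<2 * ?M. catalytic A B i x * \<psi> x)"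
  proof (rule synthesize)
    show "catalytic A B i x \<in> R12" if "i < 2 * ?M" "x < 2 * ?M" for i x
      using that AB(1)[of "i div 2" "x div 2"] R12_numerals by (auto simp: catalytic_def intro: R12_mult)
    show "(\<Sum>x<2 * ?M. catalytic A B i x * cnj (catalytic A B j x)) = (if i = j then 1 else 0)"
      if "i < 2 * ?M" "j < 2 * ?M" for i j
    proof (rule catalytic_orthonormal[OF AB(1) _ that])
      show "(\<Sum>j<?M. (A i j + z8 * B i j) * cnj (A i' j + z8 * B i' j)) = (if i = i' then 1 else 0)"
        if "i < ?M" "i' < ?M" for i i'
        using orth[OF that] that AB(2) by (simp cong: sum.cong_simp)
    qed
  qed
  then obtain G where G: "G \<in> gen {..<2 * ?M}"
    "\<And>\<psi> i. i < 2 * ?M \<Longrightarrow> G \<psi> i = (\<Sum>x<2 * ?M. catalytic A B i x * \<psi> x)" by blast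
  have "rep (Suc m) G" using G(1) by (intro rep_gen) auto
  then obtain F where F: "F \<in> impl (Suc (Suc m))" "\<And>\<psi>. supported (2 * ?M) \<psi> \<Longrightarrow>
     supported (2 * ?M) (G \<psi>) \<and> F (lift \<psi>) = lift (G \<psi>)" unfolding rep_def by auto
  \<comment> \<open>Wire 1 holds the eigenvector and is returned to 0 at the end; wire 0 is the
    clean ancilla that \<open>F\<close> works with. These are the two ancillas.\<close>
  let ?T = "hadamard_op 1 \<circ> (phase_op 1 (z8 ^ 1) \<circ> (F \<circ> (phase_op 1 (z8 ^ 7) \<circ> hadamard_op 1)))"
  have "?T \<in> impl (m + 2)" using F(1) by (intro impl_comp impl_hadamard_op impl_phase_op_z8) auto
  moreover have "?T (lift (lift u)) = lift (lift (\<lambda>i. if i < ?M then \<Sum>j<?M. V i j * u j else 0))" (is "_ = lift (lift ?v)")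
    if u: "supported ?M u" for u
  proof -
    have s: "supported (2 * ?M) (catalyst_state w)" if "supported ?M w" for w
      using that by (auto simp: supported_def catalyst_state_def)
    have v: "supported ?M ?v" by (simp add: supported_def)
    have "G (catalyst_state u) x = catalyst_state ?v x" for x
    proof (cases "x < 2 * ?M")
      case True
      then have "x div 2 < ?M" by auto
      then show ?thesis using True AB(2) by (simp add: G(2) catalytic_catalyst_state) (simp add: catalyst_state_def)
    next
      case False
      then show ?thesis using F(2)[OF s[OF u]] s[OF v] by (simp add: supported_def)
    qed
    then have "F (lift (catalyst_state u)) = lift (catalyst_state ?v)" using F(2)[OF s[OF u]] by presburger
    then show ?thesis
      by (simp add: hadamard_op_lift phase_op_lift prepare unprepare)
  qed
  ultimately show ?thesis by blast
qed

subsection \<open>Circuit matrices\<close>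

definition state_of :: "nat \<Rightarrow> complex vec \<Rightarrow> state" where
  "state_of k v = (\<lambda>x. if x < 2 ^ k then v $ x else 0)"

lemma qbit_bit: "qbit j x = of_bool (bit x j)"
  by (simp add: qbit_def bit_iff_odd odd_iff_mod_2_eq_one)

lemma same_other_bits: "(\<forall>j. j \<noteq> q \<longrightarrow> qbit j r = qbit j c) \<longleftrightarrow> c = r \<or> c = flip_bit q r"
proof
  assume h: "\<forall>j. j \<noteq> q \<longrightarrow> qbit j r = qbit j c"
  show "c = r \<or> c = flip_bit q r"
  proof (cases "bit c q = bit r q")
    case True
    have "c = r" using h True by (intro bit_eqI) (metis of_bool_eq_iff qbit_bit)
    then show ?thesis ..
  next
    case False
    have "c = flip_bit q r" using h False by (intro bit_eqI) (metis bit_flip_nat of_bool_eq_iff qbit_bit)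
    then show ?thesis ..
  qed
qed (auto simp: qbit_bit split: if_splits)

lemma single_on_mult:
  assumes "q < k" "v \<in> carrier_vec (2 ^ k)" "r < 2 ^ k"
  shows "(single_on k g q *\<^sub>v v) $ r =
    g $$ (qbit q r, qbit q r) * v $ r + g $$ (qbit q r, 1 - qbit q r) * v $ flip_bit q r"
proof -
  have f: "flip_bit q r < 2 ^ k" "flip_bit q r \<noteq> r"
    using assms bit_flip_nat[of q r q] by (simp add: flip_bit_less_iff, metis)
  have "(single_on k g q *\<^sub>v v) $ r = (\<Sum>c<2 ^ k. (if c = r \<or> c = flip_bit q r then g $$ (qbit q r, qbit q c) else 0) * v $ c)"
    using assms by (simp add: single_on_def scalar_prod_def same_other_bits lessThan_atLeast0)
  also have "\<dots> = (\<Sum>c\<in>{r, flip_bit q r}. (if c = r \<or> c = flip_bit q r then g $$ (qbit q r, qbit q c) else 0) * v $ c)"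
    using f assms by (intro sum.mono_neutral_right) auto
  also have "\<dots> = g $$ (qbit q r, qbit q r) * v $ r + g $$ (qbit q r, 1 - qbit q r) * v $ flip_bit q r"
    using f by (auto simp: qbit_bit)
  finally show ?thesis .
qed

lemma gate_mat_carrier: "gate_mat k g \<in> carrier_mat (2 ^ k) (2 ^ k)"
  by (cases g) (auto simp: single_on_def cx_on_def)

lemma dim_gate [simp]: "dim_row (single_on k g q) = 2 ^ k" "dim_row (cx_on k c t) = 2 ^ k"
  "dim_col (single_on k g q) = 2 ^ k" "dim_col (cx_on k c t) = 2 ^ k"
  by (simp_all add: single_on_def cx_on_def)

lemma state_of_Hgate:
  assumes "q < k" "v \<in> carrier_vec (2 ^ k)"
  shows "state_of k (single_on k Hgate q *\<^sub>v v) = hadamard_op q (state_of k v)"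
proof
  fix x
  show "state_of k (single_on k Hgate q *\<^sub>v v) x = hadamard_op q (state_of k v) x"
    using single_on_mult[OF assms, of x Hgate] flip_bit_less_iff[OF assms(1), of x]
    by (auto simp: state_of_def hadamard_op_def Hgate_def qbit_bit add_divide_distrib simp del: index_mult_mat_vec)
qed

lemma state_of_diag:
  assumes "q < k" "v \<in> carrier_vec (2 ^ k)"
    "g = mat 2 2 (\<lambda>(i,j). if i \<noteq> j then 0 else if i = 0 then 1 else z)"
  shows "state_of k (single_on k g q *\<^sub>v v) = phase_op q z (state_of k v)"
proof
  fix x
  show "state_of k (single_on k g q *\<^sub>v v) x = phase_op q z (state_of k v) x"
    using single_on_mult[OF assms(1,2), of x g]
    by (auto simp: state_of_def phase_op_def diag_op_def assms(3) qbit_bit simp del: index_mult_mat_vec)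
qed

lemma cx_map_eq: "cx_map c t x = mcmap {c} t x"
proof -
  have "flip_bit t x = (if bit x t then x - 2 ^ t else x + 2 ^ t)"
  proof -
    have *: "flip_bit t y = y + 2 ^ t" if "\<not> bit y t" for y :: nat
      using that by (simp add: flip_bit_eq_if set_bit_eq)
    show ?thesis using *[of x] *[of "flip_bit t x"] by auto
  qed
  then show ?thesis by (simp add: cx_map_def mcmap_def qbit_bit)
qed

lemma mcmap_less: "t < k \<Longrightarrow> mcmap A t x < 2 ^ k \<longleftrightarrow> x < 2 ^ k"
  by (simp add: mcmap_def flip_bit_less_iff)

lemma state_of_cx:
  assumes "c < k" "t < k" "c \<noteq> t" "v \<in> carrier_vec (2 ^ k)"
  shows "state_of k (cx_on k c t *\<^sub>v v) = mcx {c} t (state_of k v)"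
proof
  fix r
  have inv: "r = mcmap {c} t y \<longleftrightarrow> y = mcmap {c} t r" for y
    using assms(3) by (auto simp: mcmap_def)
  have "(cx_on k c t *\<^sub>v v) $ r = v $ mcmap {c} t r" if "r < 2 ^ k"
  proof -
    have "(cx_on k c t *\<^sub>v v) $ r = (\<Sum>y<2 ^ k. (if y = mcmap {c} t r then 1 else 0) * v $ y)"
      using that assms by (simp add: cx_on_def scalar_prod_def cx_map_eq inv lessThan_atLeast0)
    also have "\<dots> = (\<Sum>y<2 ^ k. if y = mcmap {c} t r then v $ y else 0)"
      by (intro sum.cong) auto
    finally show ?thesis using that assms by (simp add: mcmap_less)
  qed
  then show "state_of k (cx_on k c t *\<^sub>v v) r = mcx {c} t (state_of k v) r"
    using assms by (simp add: state_of_def perm_op_def mcmap_less del: index_mult_mat_vec)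
qed

lemma circuit_mat_snoc: "circuit_mat k (C @ [g]) = gate_mat k g * circuit_mat k C"
  by (simp add: circuit_mat_def)

lemma circuit_mat_carrier: "circuit_mat k C \<in> carrier_mat (2 ^ k) (2 ^ k)"
proof (induction C rule: rev_induct)
  case Nil then show ?case by (simp add: circuit_mat_def)
next
  case (snoc g C)
  then show ?case unfolding circuit_mat_snoc using gate_mat_carrier by (rule mult_carrier_mat[rotated])
qed

lemma circuit_mat_snoc_vec:
  assumes "v \<in> carrier_vec (2 ^ k)"
  shows "circuit_mat k (C @ [g]) *\<^sub>v v = gate_mat k g *\<^sub>v (circuit_mat k C *\<^sub>v v)"
  unfolding circuit_mat_snoc using assms gate_mat_carrier circuit_mat_carrier by (rule assoc_mult_mat_vec[rotated 2])

lemma gate_impl: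
  assumes "valid_gate 24 k g"
  shows "\<exists>F\<in>impl k. \<forall>v\<in>carrier_vec (2 ^ k). state_of k (gate_mat k g *\<^sub>v v) = F (state_of k v)"
proof (cases g)
  case (Single h q)
  then consider "h = Hgate" | "h = Sgate" | "h = Tgate 24" using assms by auto
  moreover have "q < k" using assms Single by simp
  ultimately show ?thesis
  proof cases
    case 1
    then show ?thesis using \<open>q < k\<close> Single by (intro bexI[OF _ impl_hadamard_op]) (auto simp: state_of_Hgate)
  next
    case 2
    then show ?thesis using \<open>q < k\<close> Single
      by (intro bexI[OF _ impl_phase_op_z8[of q k 2]]) (auto simp: state_of_diag[OF _ _ Sgate_def] z8_powers)
  next
    case 3
    then show ?thesis using \<open>q < k\<close> Single
      by (intro bexI[OF _ impl_phase_op_power[of q k 1]]) (auto simp: state_of_diag[OF _ _ Tgate_def])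
  qed
next
  case (CNOT c t)
  then show ?thesis using assms by (intro bexI[OF _ impl_cx]) (auto simp: state_of_cx)
qed

lemma circuit_impl:
  assumes "circuit_over 24 k C"
  shows "\<exists>F\<in>impl k. \<forall>v\<in>carrier_vec (2 ^ k). state_of k (circuit_mat k C *\<^sub>v v) = F (state_of k v)"
  using assms
proof (induction C rule: rev_induct)
  case Nil
  then show ?case by (intro bexI[OF _ impl_id]) (simp add: circuit_mat_def)
next
  case (snoc g C)
  then obtain F where F: "F \<in> impl k" "\<forall>v\<in>carrier_vec (2 ^ k). state_of k (circuit_mat k C *\<^sub>v v) = F (state_of k v)"
    unfolding circuit_over_def by auto
  obtain E where E: "E \<in> impl k" "\<forall>v\<in>carrier_vec (2 ^ k). state_of k (gate_mat k g *\<^sub>v v) = E (state_of k v)"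
    using snoc.prems gate_impl[of k g] unfolding circuit_over_def by auto
  have "state_of k (circuit_mat k (C @ [g]) *\<^sub>v v) = (E \<circ> F) (state_of k v)" if "v \<in> carrier_vec (2 ^ k)" for v
    using E(2) F(2) that mult_mat_vec_carrier[OF circuit_mat_carrier that] by (simp add: circuit_mat_snoc_vec)
  then show ?case using impl_comp[OF E(1) F(1)] by blast
qed

lemma impl_circuit:
  assumes "F \<in> impl k"
  shows "\<exists>C. circuit_over 24 k C \<and> (\<forall>v\<in>carrier_vec (2 ^ k). state_of k (circuit_mat k C *\<^sub>v v) = F (state_of k v))"
proof -
  have step: "\<exists>C. circuit_over 24 k C \<and> (\<forall>v\<in>carrier_vec (2 ^ k). state_of k (circuit_mat k C *\<^sub>v v) = (E \<circ> F) (state_of k v))"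
    if ex: "\<exists>C. circuit_over 24 k C \<and> (\<forall>v\<in>carrier_vec (2 ^ k). state_of k (circuit_mat k C *\<^sub>v v) = F (state_of k v))"
      and g: "valid_gate 24 k g" "\<And>v. v \<in> carrier_vec (2 ^ k) \<Longrightarrow> state_of k (gate_mat k g *\<^sub>v v) = E (state_of k v)" for E F g
  proof -
    obtain C where C: "circuit_over 24 k C" "\<forall>v\<in>carrier_vec (2 ^ k). state_of k (circuit_mat k C *\<^sub>v v) = F (state_of k v)"
      using ex by blast
    have "circuit_over 24 k (C @ [g])" using C(1) g(1) by (auto simp: circuit_over_def)
    moreover have "state_of k (circuit_mat k (C @ [g]) *\<^sub>v v) = (E \<circ> F) (state_of k v)" if "v \<in> carrier_vec (2 ^ k)" for v
      using C(2) that g(2) mult_mat_vec_carrier[OF circuit_mat_carrier that]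
      by (simp add: circuit_mat_snoc_vec)
    ultimately show ?thesis by blast
  qed
  show ?thesis using assms
  proof induction
    case impl_id
    show ?case by (intro exI[of _ "[]"]) (simp add: circuit_over_def circuit_mat_def)
  next
    case (impl_h f q)
    then show ?case by (intro step[where g = "Single Hgate q"]) (auto simp: state_of_Hgate)
  next
    case (impl_t f q)
    then show ?case
      by (intro step[where g = "Single (Tgate 24) q"]) (auto simp: state_of_diag[OF _ _ Tgate_def])
  next
    case (impl_c f c t)
    then show ?case by (intro step[where g = "CNOT c t"]) (auto simp: state_of_cx)
  qed
qed

section \<open>Ancillas and the sufficiency of the conditions\<close>

lemma state_of_inject:
  assumes "v \<in> carrier_vec (2 ^ k)" "w \<in> carrier_vec (2 ^ k)" "state_of k v = state_of k w" shows "v = w"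
proof (rule eq_vecI)
  fix i assume "i < dim_vec w"
  then show "v $ i = w $ i" using assms(2) fun_cong[OF assms(3), of i] by (simp add: state_of_def)
qed (use assms in simp)

lemma with_ancillas_carrier: "u \<in> carrier_vec (2 ^ m) \<Longrightarrow> with_ancillas a u \<in> carrier_vec (2 ^ (m + a))"
  by (auto simp: with_ancillas_def power_add)

lemma state_of_with_ancillas:
  assumes "u \<in> carrier_vec (2 ^ m)"
  shows "state_of (m + a) (with_ancillas a u) = (\<lambda>x. if x mod 2 ^ a = 0 then state_of m u (x div 2 ^ a) else 0)"
proof
  fix x :: nat
  have "x < 2 ^ (m + a) \<longleftrightarrow> x div 2 ^ a < 2 ^ m"
    by (simp add: power_add div_less_iff_less_mult)
  then show "state_of (m + a) (with_ancillas a u) x = (if x mod 2 ^ a = 0 then state_of m u (x div 2 ^ a) else 0)"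
    using assms by (auto simp: state_of_def with_ancillas_def power_add)
qed

text \<open>In the row-major convention the ancillas occupy the two lowest bits, which is where two
  applications of \<open>lift\<close> put them.\<close>

lemma state_of_with_2_ancillas:
  assumes "u \<in> carrier_vec (2 ^ m)"
  shows "state_of (m + 2) (with_ancillas 2 u) = lift (lift (state_of m u))"
proof -
  have "x mod 4 = 0 \<longleftrightarrow> even x \<and> even (x div 2)" for x :: nat by presburger
  moreover have "x div 2 div 2 = x div 4" for x :: nat by simp
  ultimately show ?thesis
    unfolding state_of_with_ancillas[OF assms] lift_def by (auto simp: fun_eq_iff)
qed

lemma exactly_represents_2:
  assumes U: "U \<in> carrier_mat (2 ^ m) (2 ^ m)" and un: "unitary_mat (2 ^ m) U"
    and R: "\<And>i j. i < 2 ^ m \<Longrightarrow> j < 2 ^ m \<Longrightarrow> U $$ (i, j) \<in> Rring 24"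
  shows "exactly_represents 24 m 2 U"
proof -
  have "(\<Sum>j<2 ^ m. U $$ (i, j) * cnj (U $$ (i', j))) = (if i = i' then 1 else 0)" if "i < 2 ^ m" "i' < 2 ^ m" for i i'
  proof -
    have "(\<Sum>j<2 ^ m. U $$ (i, j) * cnj (U $$ (i', j))) = (U * adjoint_mat U) $$ (i, i')"
      using U that by (simp add: adjoint_mat_def scalar_prod_def lessThan_atLeast0)
    also have "\<dots> = (if i = i' then 1 else 0)" using un that unfolding unitary_mat_def by simp
    finally show ?thesis .
  qed
  from synthesize_R24[where V = "\<lambda>i j. U $$ (i, j)", OF R this]
  obtain F where F: "F \<in> impl (m + 2)" "\<And>u. supported (2 ^ m) u \<Longrightarrow>
    F (lift (lift u)) = lift (lift (\<lambda>i. if i < 2 ^ m then \<Sum>j<2 ^ m. U $$ (i, j) * u j else 0))"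
    by blast
  obtain C where C: "circuit_over 24 (m + 2) C"
    "\<And>v. v \<in> carrier_vec (2 ^ (m + 2)) \<Longrightarrow> state_of (m + 2) (circuit_mat (m + 2) C *\<^sub>v v) = F (state_of (m + 2) v)"
    using impl_circuit[OF F(1)] by blast
  have "circuit_mat (m + 2) C *\<^sub>v with_ancillas 2 u = with_ancillas 2 (U *\<^sub>v u)" if u: "u \<in> carrier_vec (2 ^ m)" for u
  proof (rule state_of_inject)
    have Uu: "U *\<^sub>v u \<in> carrier_vec (2 ^ m)" using U u by simp
    show "circuit_mat (m + 2) C *\<^sub>v with_ancillas 2 u \<in> carrier_vec (2 ^ (m + 2))"
      using mult_mat_vec_carrier[OF circuit_mat_carrier with_ancillas_carrier[OF u]] .
    show "with_ancillas 2 (U *\<^sub>v u) \<in> carrier_vec (2 ^ (m + 2))" using with_ancillas_carrier[OF Uu] .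
    have "state_of m (U *\<^sub>v u) = (\<lambda>i. if i < 2 ^ m then \<Sum>j<2 ^ m. U $$ (i, j) * state_of m u j else 0)"
      using U u by (auto simp: state_of_def scalar_prod_def lessThan_atLeast0 fun_eq_iff intro!: sum.cong)
    moreover have "supported (2 ^ m) (state_of m u)" by (simp add: supported_def state_of_def)
    ultimately show "state_of (m + 2) (circuit_mat (m + 2) C *\<^sub>v with_ancillas 2 u) = state_of (m + 2) (with_ancillas 2 (U *\<^sub>v u))"
      by (simp only: C(2)[OF with_ancillas_carrier[OF u]] state_of_with_2_ancillas[OF u] state_of_with_2_ancillas[OF Uu] F(2))
  qed
  then show ?thesis unfolding exactly_represents_def using C(1) by blast
qed

section \<open>Necessity of the conditions\<close>

lemma Rring_0: "0 \<in> Rring n"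
  using Rring.add[OF Rring.one Rring.neg[OF Rring.one]] by simp

lemma Rring_power: "x \<in> Rring n \<Longrightarrow> x ^ k \<in> Rring n"
  by (induction k) (auto intro: Rring.one Rring.mul)

text \<open>1/sqrt 2 is half the sum of \<open>z8\<close> and its inverse \<open>z8 ^ 7\<close>,
  both powers of \<open>zeta 24\<close>.\<close>

lemma Rring_divide_sqrt2:
  assumes "z \<in> Rring 24" shows "z / complex_of_real (sqrt 2) \<in> Rring 24"
proof -
  have "z8 ^ k \<in> Rring 24" for k unfolding z8_eq by (intro Rring_power Rring.zet)
  from this[of 1] this[of 7] have "1/2 * (z8 + z8 ^ 7) * z \<in> Rring 24"
    using assms by (intro Rring.mul Rring.add Rring.half) auto
  moreover have "1/2 * (z8 + z8 ^ 7) * z = z / complex_of_real (sqrt 2)"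
    unfolding z8_power_7 by (simp add: z8_def field_simps)
  ultimately show ?thesis by simp
qed

lemma impl_Rring: "F \<in> impl k \<Longrightarrow> (\<And>x. \<psi> x \<in> Rring 24) \<Longrightarrow> F \<psi> x \<in> Rring 24"
proof (induction F arbitrary: x rule: impl.induct)
  case (impl_h f q)
  then show ?case unfolding comp_apply hadamard_op_def by (intro Rring_divide_sqrt2 Rring.add) (auto intro: Rring.neg)
next
  case (impl_t f q)
  then show ?case by (auto simp: phase_op_def diag_op_def intro: Rring.mul Rring.zet)
qed (auto simp: perm_op_def)

lemma sum_flip:
  assumes "q < k" shows "(\<Sum>x<2 ^ k. f (flip_bit q x)) = (\<Sum>x<2 ^ k. f (x::nat) :: complex)"
  by (rule sum.reindex_bij_witness[where i = "flip_bit q" and j = "flip_bit q"]) (auto simp: flip_bit_less_iff assms)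

lemma impl_inner: "F \<in> impl k \<Longrightarrow> inner {..<2 ^ k} (F \<phi>) (F \<psi>) = inner {..<2 ^ k} \<phi> \<psi>"
proof (induction F rule: impl.induct)
  case (impl_h f q)
  let ?a = "f \<phi>" and ?b = "f \<psi>"
  let ?s = "\<lambda>x. if bit x q then - 1 else (1::complex)"
  let ?g = "\<lambda>x. ?s x * (cnj (?a x) * ?b (flip_bit q x) + cnj (?a (flip_bit q x)) * ?b x)"
  \<comment> \<open>The cross terms \<open>?g\<close> change sign when bit \<open>q\<close> is
    flipped, so they cancel in pairs.\<close>
  have "sum ?g {..<2 ^ k} = (\<Sum>x<2 ^ k. ?g (flip_bit q x))" by (rule sum_flip[OF impl_h(2), of ?g, symmetric])
  also have "\<dots> = (\<Sum>x<2 ^ k. - ?g x)" by (intro sum.cong) auto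
  also have "\<dots> = - sum ?g {..<2 ^ k}" by (rule sum_negf)
  finally have g: "sum ?g {..<2 ^ k} = 0" by simp
  have "cnj (hadamard_op q ?a x) * hadamard_op q ?b x =
    (cnj (?a x) * ?b x + cnj (?a (flip_bit q x)) * ?b (flip_bit q x) + ?g x) / 2" for x
    by (auto simp: hadamard_op_def field_simps)
  then have "inner {..<2 ^ k} (hadamard_op q ?a) (hadamard_op q ?b) = (inner {..<2 ^ k} ?a ?b +
      (\<Sum>x<2 ^ k. cnj (?a (flip_bit q x)) * ?b (flip_bit q x)) + sum ?g {..<2 ^ k}) / 2"
    unfolding inner_def by (simp only: sum_divide_distrib[symmetric] sum.distrib)
  also have "(\<Sum>x<2 ^ k. cnj (?a (flip_bit q x)) * ?b (flip_bit q x)) = inner {..<2 ^ k} ?a ?b"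
    unfolding inner_def by (rule sum_flip[OF impl_h(2)])
  finally show ?case using impl_h.IH g by simp
next
  case (impl_t f q)
  have "cnj (phase_op q (zeta 24) a x) * phase_op q (zeta 24) b x = cnj (a x) * b x" for a b x
    using zeta_cnj_mult[of 24 1] by (auto simp: phase_op_def diag_op_def)
  then show ?case using impl_t by (simp add: inner_def)
next
  case (impl_c f c t)
  have "inner {..<2 ^ k} (mcx {c} t a) (mcx {c} t b) = inner {..<2 ^ k} a b" for a b
    unfolding inner_def perm_op_def using impl_c(2-4)
    by (intro sum.reindex_bij_witness[where i = "mcmap {c} t" and j = "mcmap {c} t"])
       (auto simp: mcmap_less, auto simp: mcmap_def)
  then show ?case using impl_c by simp
qed simp

text \<open>On the basis state with index \<open>j * 2 ^ a\<close> the circuit produces column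
  \<open>j\<close> of \<open>U\<close> at the multiples of \<open>2 ^ a\<close> and zero elsewhere.
  So the entries are values of a circuit on a 0-1 function, and the columns inherit the inner
  products of basis states. A left inverse of a square matrix is also a right inverse.\<close>

lemma represented_unitary:
  assumes U: "U \<in> carrier_mat (2 ^ m) (2 ^ m)" and r: "exactly_represents 24 m a U"
  shows "unitary_mat (2 ^ m) U \<and> (\<forall>i<2 ^ m. \<forall>j<2 ^ m. U $$ (i, j) \<in> Rring 24)"
proof -
  obtain C where C: "circuit_over 24 (m + a) C" "\<And>u. u \<in> carrier_vec (2 ^ m) \<Longrightarrow>
     circuit_mat (m + a) C *\<^sub>v with_ancillas a u = with_ancillas a (U *\<^sub>v u)"
    using r unfolding exactly_represents_def by blast
  obtain F where F: "F \<in> impl (m + a)" "\<And>v. v \<in> carrier_vec (2 ^ (m + a)) \<Longrightarrow>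
     state_of (m + a) (circuit_mat (m + a) C *\<^sub>v v) = F (state_of (m + a) v)"
    using circuit_impl[OF C(1)] by blast
  have cU: "col U j \<in> carrier_vec (2 ^ m)" for j using U by (intro carrier_vecI) simp
  have col: "F (unitvec (j * 2 ^ a)) = (\<lambda>x. if x mod 2 ^ a = 0 then state_of m (col U j) (x div 2 ^ a) else 0)"
    if j: "j < 2 ^ m" for j
  proof -
    let ?e = "unit_vec (2 ^ m) j :: complex vec"
    have "state_of (m + a) (with_ancillas a ?e) = unitvec (j * 2 ^ a)"
      unfolding state_of_with_ancillas[OF unit_vec_carrier]
      using j by (auto simp: fun_eq_iff unitvec_def state_of_def unit_vec_def)
    moreover have "U *\<^sub>v ?e = col U j" using U j by (intro eq_vecI) auto
    ultimately show ?thesis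
      using F(2)[OF with_ancillas_carrier[OF unit_vec_carrier[of "2 ^ m" j]]] C(2)[OF unit_vec_carrier[of "2 ^ m" j]]
      by (simp add: state_of_with_ancillas[OF cU])
  qed
  have entry: "F (unitvec (j * 2 ^ a)) (i * 2 ^ a) = U $$ (i, j)" if "i < 2 ^ m" "j < 2 ^ m" for i j
    using that U by (simp add: col state_of_def)
  have "U $$ (i, j) \<in> Rring 24" if "i < 2 ^ m" "j < 2 ^ m" for i j
    unfolding entry[OF that, symmetric]
    by (rule impl_Rring[OF F(1)]) (auto simp: unitvec_def Rring_0 Rring.one)
  moreover have "(\<Sum>i<2 ^ m. cnj (U $$ (i, j)) * U $$ (i, l)) = (if j = l then 1 else 0)"
    if "j < 2 ^ m" "l < 2 ^ m" for j l
  proof -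
    let ?f = "\<lambda>x. cnj (F (unitvec (j * 2 ^ a)) x) * F (unitvec (l * 2 ^ a)) x"
    let ?N = "2 ^ (m + a) :: nat"
    have lt: "i * 2 ^ a < ?N \<longleftrightarrow> i < 2 ^ m" for i by (simp add: power_add)
    have "(\<Sum>i<2 ^ m. cnj (U $$ (i, j)) * U $$ (i, l)) = (\<Sum>i<2 ^ m. ?f (i * 2 ^ a))"
      using that by (intro sum.cong) (auto simp: entry)
    also have "\<dots> = sum ?f ((\<lambda>i. i * 2 ^ a) ` {..<2 ^ m})"
      by (subst sum.reindex) (auto simp: inj_on_def)
    also have "\<dots> = sum ?f {..<?N}"
    proof (rule sum.mono_neutral_left)
      show "\<forall>x\<in>{..<?N} - (\<lambda>i. i * 2 ^ a) ` {..<2 ^ m}. ?f x = 0"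
      proof
        fix x assume x: "x \<in> {..<?N} - (\<lambda>i. i * 2 ^ a) ` {..<2 ^ m}"
        have "x mod 2 ^ a \<noteq> 0"
        proof
          assume "x mod 2 ^ a = 0"
          then obtain i where "x = i * 2 ^ a" by (metis dvd_div_mult_self mod_0_imp_dvd)
          then show False using x by (auto simp: lt)
        qed
        then show "?f x = 0" by (simp add: col that)
      qed
    qed (auto simp: lt)
    also have "\<dots> = inner {..<?N} (unitvec (j * 2 ^ a)) (unitvec (l * 2 ^ a))"
      using impl_inner[OF F(1)] by (simp add: inner_def)
    also have "\<dots> = (if j = l then 1 else 0)"
      using that by (simp add: inner_unitvec lt) (simp add: unitvec_def)
    finally show ?thesis .
  qed
  moreover have A: "adjoint_mat U \<in> carrier_mat (2 ^ m) (2 ^ m)" using U by (simp add: adjoint_mat_def)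
  ultimately have "adjoint_mat U * U = 1\<^sub>m (2 ^ m)"
    using U by (intro eq_matI) (auto simp: adjoint_mat_def scalar_prod_def lessThan_atLeast0)
  moreover from this have "U * adjoint_mat U = 1\<^sub>m (2 ^ m)"
    using mat_mult_left_right_inverse[OF A U] by simp
  ultimately show ?thesis
    using U \<open>\<And>i j. i < 2 ^ m \<Longrightarrow> j < 2 ^ m \<Longrightarrow> U $$ (i, j) \<in> Rring 24\<close> by (simp add: unitary_mat_def)
qed

theorem theorem7p7:
  fixes m :: nat and U :: "complex mat"
  assumes "m \<ge> 1" and "U \<in> carrier_mat (2^m) (2^m)"
  shows "((\<exists>a. exactly_represents 24 m a U) \<longleftrightarrow>
            (unitary_mat (2^m) U \<and> (\<forall>i < 2^m. \<forall>j < 2^m. U $$ (i,j) \<in> Rring 24)))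
         \<and> (unitary_mat (2^m) U \<and> (\<forall>i < 2^m. \<forall>j < 2^m. U $$ (i,j) \<in> Rring 24)
             \<longrightarrow> exactly_represents 24 m 2 U)"
  using represented_unitary[OF assms(2)] exactly_represents_2[OF assms(2)] by blast

end
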